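(* Let $m=2n\ge4$, let $U\subset\mathbb{R}^{2n}$ be a (connected, open) domain, let $\vec F=(-x^2,x^1,\dots,-x^{2n},x^{2n-1})$, and let $u,v$ be real-valued $C^2$ functions on $U$ such that $\nabla u+\vec F\neq0$ and $\nabla v+\vec F\ne0$ everywhere in $U$. Suppose $H_{\vec F}(u)\le H_{\vec F}(v)$ and $u\ge v$ in $U$, and $u=v$ at a point $p_0\in U$. Then $u\equiv v$ in $U$.
   Context: $N_{\vec F}(u):=\frac{\nabla u+\vec F}{|\nabla u+\vec F|}$ and $H_{\vec F}(u):=\operatorname{div}N_{\vec F}(u)$ at points where $\nabla u+\vec F\ne0$ (Euclidean gradient, norm and divergence on $\mathbb{R}^{2n}$, coordinates $x^1,\dots,x^{2n}$); similarly for $v$. *)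

theory Defs
  imports "HOL-Analysis.Analysis"
begin

definition partial_deriv :: "'m::finite \<Rightarrow> (real ^ 'm \<Rightarrow> real) \<Rightarrow> real ^ 'm \<Rightarrow> real" where
  "partial_deriv i f x = frechet_derivative f (at x) (axis i 1)"

definition grad :: "(real ^ 'm::finite \<Rightarrow> real) \<Rightarrow> real ^ 'm \<Rightarrow> real ^ 'm" where
  "grad f x = (\<chi> i. partial_deriv i f x)"

definition divergence :: "(real ^ 'm::finite \<Rightarrow> real ^ 'm) \<Rightarrow> real ^ 'm \<Rightarrow> real" where
  "divergence X x = (\<Sum>i\<in>UNIV. partial_deriv i (\<lambda>y. X y $ i) x)"

lemma GDERIV_grad:
  fixes f :: "real ^ 'm::finite \<Rightarrow> real"
  assumes "f differentiable (at x)"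
  shows "GDERIV f x :> grad f x"
proof -
  let ?D = "frechet_derivative f (at x)"
  have D: "(f has_derivative ?D) (at x)"
    using assms by (simp add: frechet_derivative_works)
  then have lin: "linear ?D"
    by (rule has_derivative_linear)
  have "?D h = inner h (grad f x)" for h
  proof -
    have "?D h = ?D (\<Sum>i\<in>UNIV. h $ i *\<^sub>R axis i 1)"
      using basis_expansion[of h] by (simp add: scalar_mult_eq_scaleR)
    also have "\<dots> = (\<Sum>i\<in>UNIV. h $ i * ?D (axis i 1))"
      by (simp add: linear_sum[OF lin] linear_cmul[OF lin])
    also have "\<dots> = inner h (grad f x)"
      by (simp add: inner_vec_def grad_def partial_deriv_def)
    finally show ?thesis .
  qed
  then have "?D = (\<lambda>h. inner h (grad f x))" by blast
  then show ?thesis using D by (simp add: gderiv_def)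
qed

(* Intended for open sets S, where differentiability within S and at the points of S agree. *)
primrec C_k_on :: "nat \<Rightarrow> (real ^ 'm::finite \<Rightarrow> real) \<Rightarrow> (real ^ 'm) set \<Rightarrow> bool" where
  "C_k_on 0 f S \<longleftrightarrow> continuous_on S f"
| "C_k_on (Suc k) f S \<longleftrightarrow>
     f differentiable_on S \<and> (\<forall>i. C_k_on k (partial_deriv i f) S)"

(* The enumeration e lists the index type as e 1, ..., e (2 * n), so that the classical
   coordinate x^k is x $ e k; the field is (-x^2, x^1, ..., -x^{2n}, x^{2n-1}). *)
definition twist_field :: "nat \<Rightarrow> (nat \<Rightarrow> 'm) \<Rightarrow> real ^ 'm::finite \<Rightarrow> real ^ 'm" where
  "twist_field n e x =
     (\<Sum>k = 1..n. (- (x $ e (2 * k))) *\<^sub>R axis (e (2 * k - 1)) 1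
                  + (x $ e (2 * k - 1)) *\<^sub>R axis (e (2 * k)) 1)"

definition N_field :: "(real ^ 'm::finite \<Rightarrow> real ^ 'm) \<Rightarrow> (real ^ 'm \<Rightarrow> real) \<Rightarrow> real ^ 'm \<Rightarrow> real ^ 'm" where
  "N_field F u x = (1 / norm (grad u x + F x)) *\<^sub>R (grad u x + F x)"

definition H_curv :: "(real ^ 'm::finite \<Rightarrow> real ^ 'm) \<Rightarrow> (real ^ 'm \<Rightarrow> real) \<Rightarrow> real ^ 'm \<Rightarrow> real" where
  "H_curv F u x = divergence (N_field F u) x"

end

theory Submission
  imports Defs
begin

text \<open>
  Write \<open>\<alpha> = \<nabla>u + F\<close> and let \<open>Z\<close> be the contact set \<open>{u = v}\<close>. The symbol of the linearised operator is
  the orthogonal projection along \<open>\<alpha>\<close>, up to a positive factor, so a Hopf barrier shows: where a \<open>C\<^sup>2\<close>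
  function restricted to \<open>Z\<close> has a local minimum, its gradient is parallel to \<open>\<alpha>\<close>.

  This alone forces \<open>Z\<close> to be open, without flows of vector fields. The field \<open>F\<close> is a linear complex
  structure \<open>J\<close>. If \<open>Z \<noteq> U\<close>, some ball in the complement touches \<open>Z\<close> at a point \<open>x\<close>, with normal
  parallel to \<open>\<alpha>(x)\<close>. For \<open>z\<close> near \<open>x\<close> with \<open>z - x \<bottom> \<alpha>(x)\<close> minimise
  \<open>\<phi>\<^sub>z(y) = \<plusminus>(u(y) + J z \<bullet> y) + \<tau>/2 |y - z|\<^sup>2\<close> over \<open>Z\<close> near \<open>x\<close>. At a minimiser \<open>y\<^sub>z\<close> the vector
  \<open>(\<tau> \<mp> J)(y\<^sub>z - z)\<close> is parallel to \<open>\<alpha>(y\<^sub>z)\<close>, whence \<open>|y\<^sub>z - z| = O(|z - x|\<^sup>2)\<close>. Summing the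
  inequalities \<open>\<phi>\<^sub>z(y\<^sub>z) \<le> \<phi>\<^sub>z(y\<^sub>z\<^sub>')\<close> over consecutive vertices \<open>z, z'\<close> of a regular polygon cancels \<open>u\<close>;
  what is left is the area of the polygon with respect to \<open>J\<close>, of the wrong sign for one orientation, and
  errors that are negligible for many vertices and small diameter. The polygon lies in a plane spanned by \<open>b\<close> and \<open>J b\<close> orthogonal to \<open>\<alpha>(x)\<close>; such a plane exists as \<open>n \<ge> 2\<close>.
\<close>

section \<open>The curvature operator\<close>

definition trace_op :: "('a::euclidean_space \<Rightarrow> 'a) \<Rightarrow> real" where
  "trace_op T = (\<Sum>b\<in>Basis. T b \<bullet> b)"

text \<open>
  With \<open>p = \<nabla>u + F\<close> and \<open>T\<close> the Hessian of \<open>u\<close> this is the expanded form of the divergence of \<open>p / |p|\<close>.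
  The Hessian is never required to be symmetric.
\<close>
definition curv_op :: "'a::euclidean_space \<Rightarrow> ('a \<Rightarrow> 'a) \<Rightarrow> real" where
  "curv_op p T = (trace_op T - sgn p \<bullet> T (sgn p)) / norm p"

text \<open>After scaling by \<open>norm p\<close> the difference becomes \<open>p - q\<close> plus
  a multiple of \<open>sgn q\<close> whose coefficient is the difference of the two norms; each
  summand has length at most \<open>norm (p - q)\<close>.\<close>

lemma norm_sgn_diff_le:
  fixes p q :: "'a::euclidean_space"
  assumes "p \<noteq> 0" "q \<noteq> 0"
  shows "norm (sgn p - sgn q) \<le> 2 * norm (p - q) / norm p"
proof -
  have n: "norm p > 0" "norm q > 0" using assms by auto
  have "norm p *\<^sub>R (sgn p - sgn q) = (p - q) + (norm q - norm p) *\<^sub>R sgn q"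
    using n by (simp add: sgn_div_norm algebra_simps)
  then have "norm p * norm (sgn p - sgn q) = norm ((p - q) + (norm q - norm p) *\<^sub>R sgn q)"
    by (metis abs_norm_cancel norm_scaleR)
  also have "\<dots> \<le> norm (p - q) + \<bar>norm q - norm p\<bar> * norm (sgn q)"
    by (metis norm_scaleR norm_triangle_ineq)
  also have "\<dots> \<le> 2 * norm (p - q)"
    using assms norm_triangle_ineq3[of q p] by (simp add: norm_sgn norm_minus_commute)
  finally show ?thesis using n by (simp add: field_simps)
qed

lemma curv_op_diff: "linear S \<Longrightarrow> linear T \<Longrightarrow> curv_op p (\<lambda>h. S h - T h) = curv_op p S - curv_op p T"
  by (simp add: curv_op_def trace_op_def inner_diff_left inner_diff_right sum_subtractf
      diff_divide_distrib)

lemma curv_op_scale: "curv_op p (\<lambda>h. c *\<^sub>R T h) = c * curv_op p T"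
  by (simp add: curv_op_def trace_op_def sum_distrib_left algebra_simps)

text \<open>Degenerate ellipticity: this turns the second-order condition at a minimum into an
  inequality between curvatures. \<open>T\<close> may fail to be symmetric, so the two mixed terms
  are kept apart.\<close>

lemma curv_op_nonneg:
  fixes T :: "'a::euclidean_space \<Rightarrow> 'a"
  assumes T: "linear T" and pos: "\<And>h. h \<bullet> T h \<ge> 0" and p: "p \<noteq> 0"
  shows "curv_op p T \<ge> 0"
proof -
  define N where "N = sgn p"
  have NN: "N \<bullet> N = 1" using p by (simp add: N_def norm_sgn flip: power2_norm_eq_inner)
  have TN: "T N = (\<Sum>b\<in>Basis. (N \<bullet> b) *\<^sub>R T b)"
    by (subst euclidean_representation[of N, symmetric])
      (simp only: linear_sum[OF T] linear_cmul[OF T])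
  have N2: "(\<Sum>b\<in>Basis. (N \<bullet> b)\<^sup>2) = 1"
    using NN by (simp add: euclidean_inner[of N N] power2_eq_square)
  \<comment> \<open>the trace of \<open>P T P\<close> for the orthogonal projection \<open>P\<close> along \<open>p\<close>\<close>
  have "(\<Sum>b\<in>Basis. (b - (N \<bullet> b) *\<^sub>R N) \<bullet> T (b - (N \<bullet> b) *\<^sub>R N))
      = (\<Sum>b\<in>Basis. T b \<bullet> b - (N \<bullet> b) * (T b \<bullet> N) - (N \<bullet> b) * (b \<bullet> T N) + (N \<bullet> b)\<^sup>2 * (N \<bullet> T N))"
    by (simp add: linear_diff[OF T] linear_cmul[OF T] algebra_simps inner_simps inner_commute
      power2_eq_square)
  also have "\<dots> = trace_op T - T N \<bullet> N - N \<bullet> T N + N \<bullet> T N"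
  proof -
    have 1: "T N \<bullet> N = (\<Sum>b\<in>Basis. (N \<bullet> b) * (T b \<bullet> N))"
      by (subst TN) (simp add: inner_sum_left)
    have 2: "N \<bullet> T N = (\<Sum>b\<in>Basis. (N \<bullet> b) * (b \<bullet> T N))"
      by (simp add: euclidean_inner[of N "T N"] inner_commute)
    have 3: "(\<Sum>b\<in>Basis. (N \<bullet> b)\<^sup>2 * (N \<bullet> T N)) = N \<bullet> T N"
      by (simp add: N2 flip: sum_distrib_right)
    show ?thesis
      unfolding sum.distrib sum_subtractf trace_op_def 3
      using 1 2 by simp
  qed
  finally have "trace_op T - N \<bullet> T N = (\<Sum>b\<in>Basis. (b - (N \<bullet> b) *\<^sub>R N) \<bullet> T (b - (N \<bullet> b) *\<^sub>R N))"
    by (simp add: inner_commute)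
  also have "\<dots> \<ge> 0" by (intro sum_nonneg pos)
  finally show ?thesis by (simp add: curv_op_def N_def)
qed

section \<open>Size of the operator and its dependence on the gradient\<close>

lemma abs_trace_op_le:
  fixes T :: "'a::euclidean_space \<Rightarrow> 'a" and B :: real
  assumes "\<And>h. norm (T h) \<le> B * norm h"
  shows "\<bar>trace_op T\<bar> \<le> DIM('a) * B"
proof -
  have "\<bar>T b \<bullet> b\<bar> \<le> B" if "b \<in> Basis" for b
    using Cauchy_Schwarz_ineq2[of "T b" b] assms[of b] that by simp
  then have "\<bar>trace_op T\<bar> \<le> (\<Sum>b\<in>(Basis::'a set). B)"
    unfolding trace_op_def by (intro order_trans[OF sum_abs] sum_mono)
  then show ?thesis by simp
qed

lemma bound_nonneg:
  fixes T :: "'a::euclidean_space \<Rightarrow> 'a" and B :: real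
  assumes "\<And>h. norm (T h) \<le> B * norm h"
  shows "B \<ge> 0"
  by (metis assms mult.right_neutral nonempty_Basis norm_Basis norm_ge_zero order_trans all_not_in_conv)

lemma abs_inner_op_le:
  fixes T :: "'a::euclidean_space \<Rightarrow> 'a" and B :: real
  assumes "\<And>h. norm (T h) \<le> B * norm h"
  shows "\<bar>x \<bullet> T y\<bar> \<le> B * norm x * norm y"
proof -
  have "\<bar>x \<bullet> T y\<bar> \<le> norm x * norm (T y)" by (rule Cauchy_Schwarz_ineq2)
  also have "\<dots> \<le> norm x * (B * norm y)" by (intro mult_left_mono assms) simp
  finally show ?thesis by (simp add: algebra_simps)
qed

lemma abs_curv_op_le:
  fixes T :: "'a::euclidean_space \<Rightarrow> 'a" and B :: real
  assumes B: "\<And>h. norm (T h) \<le> B * norm h" and "\<delta> > 0" "norm p \<ge> \<delta>"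
  shows "\<bar>curv_op p T\<bar> \<le> (DIM('a) + 1) * B / \<delta>"
proof -
  have "p \<noteq> 0" using assms by auto
  then have "\<bar>sgn p \<bullet> T (sgn p)\<bar> \<le> B"
    using abs_inner_op_le[where T=T, OF B, of "sgn p" "sgn p"] by (simp add: norm_sgn)
  then have "\<bar>trace_op T - sgn p \<bullet> T (sgn p)\<bar> \<le> (DIM('a) + 1) * B"
    using abs_trace_op_le[where T=T, OF B] by (simp add: algebra_simps)
  then show ?thesis
    unfolding curv_op_def abs_divide using assms bound_nonneg[where T=T, OF B]
    by (intro frac_le) auto
qed

text \<open>The numerator and the reciprocal norm are varied one at a time. The second contributes
  \<open>DIM('a) + 1\<close>, the bound on the numerator, and the first contributes 4, which gives
  the constant \<open>DIM('a) + 5\<close>.\<close>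

lemma curv_op_lipschitz:
  fixes T :: "'a::euclidean_space \<Rightarrow> 'a" and B :: real
  assumes T: "linear T" and B: "\<And>h. norm (T h) \<le> B * norm h"
    and d: "\<delta> > 0" and p: "norm p \<ge> \<delta>" and q: "norm q \<ge> \<delta>"
  shows "\<bar>curv_op p T - curv_op q T\<bar> \<le> (DIM('a) + 5) * B / \<delta>\<^sup>2 * norm (p - q)"
proof -
  have B0: "B \<ge> 0" using bound_nonneg[where T=T, OF B] .
  have p0: "p \<noteq> 0" "q \<noteq> 0" "norm p > 0" "norm q > 0" using d p q by auto
  define f where "f x = trace_op T - sgn x \<bullet> T (sgn x)" for x
  have "\<bar>1 / norm p - 1 / norm q\<bar> = \<bar>norm q - norm p\<bar> / (norm p * norm q)"
    using p0 by (simp add: diff_frac_eq abs_mult)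
  also have "\<dots> \<le> norm (p - q) / \<delta>\<^sup>2"
    unfolding power2_eq_square using d p q norm_triangle_ineq3[of q p]
    by (intro frac_le mult_mono) (auto simp: norm_minus_commute)
  finally have 1: "\<bar>1 / norm p - 1 / norm q\<bar> \<le> norm (p - q) / \<delta>\<^sup>2" .
  have "f q - f p = (sgn p - sgn q) \<bullet> T (sgn p) + sgn q \<bullet> T (sgn p - sgn q)"
    by (simp add: f_def linear_diff[OF T] inner_diff_left inner_diff_right)
  also have "\<bar>\<dots>\<bar> \<le> B * norm (sgn p - sgn q) + B * norm (sgn p - sgn q)"
    using abs_inner_op_le[where T=T, OF B, of "sgn p - sgn q" "sgn p"]
      abs_inner_op_le[where T=T, OF B, of "sgn q" "sgn p - sgn q"] p0
    by (simp add: norm_sgn)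
  also have "\<dots> \<le> 2 * B * (2 * norm (p - q) / norm p)"
    using mult_left_mono[OF norm_sgn_diff_le[OF p0(1,2)] B0] by simp
  also have "\<dots> \<le> 2 * B * (2 * norm (p - q) / \<delta>)"
    using d p B0 by (intro mult_left_mono frac_le) auto
  finally have 2: "\<bar>f q - f p\<bar> \<le> 4 * B * norm (p - q) / \<delta>" by simp
  have 3: "\<bar>f p\<bar> \<le> (DIM('a) + 1) * B"
    using abs_inner_op_le[where T=T, OF B, of "sgn p" "sgn p"] abs_trace_op_le[where T=T, OF B] p0
    by (simp add: f_def norm_sgn algebra_simps)
  have "curv_op p T - curv_op q T = f p * (1 / norm p - 1 / norm q) + (f p - f q) / norm q"
    by (simp add: curv_op_def f_def[symmetric] algebra_simps diff_divide_distrib)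
  also have "\<bar>\<dots>\<bar> \<le> \<bar>f p\<bar> * \<bar>1 / norm p - 1 / norm q\<bar> + \<bar>f p - f q\<bar> / norm q"
    by (rule order_trans[OF abs_triangle_ineq]) (simp add: abs_mult)
  also have "\<dots> \<le> ((DIM('a) + 1) * B) * (norm (p - q) / \<delta>\<^sup>2) + (4 * B * norm (p - q) / \<delta>) / \<delta>"
    using 1 2 3 d q B0 by (intro add_mono mult_mono frac_le) (auto simp: abs_minus_commute)
  also have "\<dots> = (DIM('a) + 5) * B / \<delta>\<^sup>2 * norm (p - q)"
    using d by (simp add: field_simps power2_eq_square)
  finally show ?thesis .
qed

section \<open>Minima over the contact set\<close>

text \<open>Reduction to a line: if \<open>h \<bullet> T h\<close> were negative, the slope of
  \<open>f\<close> along \<open>y + t *\<^sub>R h\<close>, which vanishes at 0, would be negative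
  for small positive \<open>t\<close>, and the mean value theorem would put \<open>f\<close> below
  \<open>f y\<close>. This needs the derivative of \<open>g\<close> at \<open>y\<close>
  alone.\<close>

lemma interior_min_second_order:
  fixes f :: "'a::euclidean_space \<Rightarrow> real"
  assumes S: "open S" "y \<in> S"
    and df: "\<And>x. x \<in> S \<Longrightarrow> GDERIV f x :> g x"
    and dg: "(g has_derivative T) (at y)"
    and min: "\<And>x. x \<in> S \<Longrightarrow> f y \<le> f x"
  shows "g y = 0" and "h \<bullet> T h \<ge> 0"
proof -
  have "(\<lambda>h. h \<bullet> g y) = (\<lambda>h. 0)"
    using differential_zero_maxmin[OF S(2,1), of f "\<lambda>h. h \<bullet> g y"] df[OF S(2)] min
    by (auto simp: gderiv_def)
  then show g0: "g y = 0" by (metis inner_eq_zero_iff)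
  show "h \<bullet> T h \<ge> 0"
  proof (rule ccontr)
    assume neg: "\<not> h \<bullet> T h \<ge> 0"
    define l where "l t = y + t *\<^sub>R h" for t :: real
    have l: "(l has_derivative (\<lambda>t. t *\<^sub>R h)) (at t)" for t
      unfolding l_def by (auto intro!: derivative_eq_intros)
    have l0: "l 0 = y" by (simp add: l_def)
    have lin: "linear T" using dg by (rule has_derivative_linear)
    have "((\<lambda>t. g (l t)) has_derivative (\<lambda>t. T (t *\<^sub>R h))) (at 0)"
      using has_derivative_compose[OF l[of 0], of g T] dg by (simp add: l0)
    then have "((\<lambda>t. h \<bullet> g (l t)) has_derivative (\<lambda>t. h \<bullet> T (t *\<^sub>R h))) (at 0)"
      by (intro derivative_intros)
    then have "((\<lambda>t. h \<bullet> g (l t)) has_derivative (\<lambda>t. t * (h \<bullet> T h))) (at 0)"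
      by (simp add: linear_cmul[OF lin])
    then have "((\<lambda>t. h \<bullet> g (l t)) has_real_derivative h \<bullet> T h) (at 0)"
      by (simp add: has_field_derivative_def mult_commute_abs)
    from DERIV_neg_dec_right[OF this] neg g0 l0 obtain d where d: "d > 0"
      "\<And>t. t > 0 \<Longrightarrow> t < d \<Longrightarrow> h \<bullet> g (l t) < 0" by (auto simp: not_le)
    have "isCont l 0" using has_derivative_continuous[OF l[of 0]] .
    then have "eventually (\<lambda>t. l t \<in> S) (nhds 0)"
      using S l0 by (metis eventually_nhds_in_open tendsto_def continuous_at_imp_continuous_at_within
          isCont_def tendsto_at_iff_tendsto_nhds filterlim_iff)
    then obtain c where c: "c > 0" "\<And>t. \<bar>t\<bar> < c \<Longrightarrow> l t \<in> S"
      by (auto simp: eventually_nhds_metric dist_real_def)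
    define b where "b = min c d / 2"
    have b: "b > 0" "b < c" "b < d" using c d by (auto simp: b_def)
    have dfl: "((\<lambda>t. f (l t)) has_real_derivative h \<bullet> g (l t)) (at t)" if "\<bar>t\<bar> < c" for t
    proof -
      have "((\<lambda>t. f (l t)) has_derivative (\<lambda>s. (s *\<^sub>R h) \<bullet> g (l t))) (at t)"
        using has_derivative_compose[OF l[of t] df[OF c(2)[OF that], unfolded gderiv_def]] .
      then show ?thesis by (simp add: has_field_derivative_def mult_commute_abs)
    qed
    have "\<exists>t>0. t < b \<and> f (l b) - f (l 0) = (b - 0) * (h \<bullet> g (l t))"
      using b by (intro MVT2 dfl) auto
    then obtain t where t: "0 < t" "t < b" "f (l b) - f (l 0) = b * (h \<bullet> g (l t))" by auto
    have "f (l b) < f (l 0)" using t d(2)[of t] b mult_pos_neg[of b "h \<bullet> g (l t)"] by linarith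
    moreover have "f (l 0) \<le> f (l b)" using min c(2)[of b] b l0 by auto
    ultimately show False by simp
  qed
qed

text \<open>Local boundedness of the Hessian replaces its continuity.\<close>
definition twice_diff ::
    "('a::euclidean_space \<Rightarrow> real) \<Rightarrow> ('a \<Rightarrow> 'a) \<Rightarrow> ('a \<Rightarrow> 'a \<Rightarrow> 'a) \<Rightarrow> 'a set \<Rightarrow> bool" where
  "twice_diff f g T S \<longleftrightarrow>
     (\<forall>x\<in>S. GDERIV f x :> g x \<and> (g has_derivative T x) (at x) \<and>
       (\<exists>B. \<forall>\<^sub>F y in nhds x. \<forall>h. norm (T y h) \<le> B * norm h))"

lemma twice_diffD:
  assumes "twice_diff f g T S" "x \<in> S"
  shows "GDERIV f x :> g x" "(g has_derivative T x) (at x)" "linear (T x)" "isCont f x" "isCont g x"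
    "\<exists>B. \<forall>\<^sub>F y in nhds x. \<forall>h. norm (T y h) \<le> B * norm h"
  using assms
  by (auto simp: twice_diff_def gderiv_def dest: has_derivative_linear
      intro: has_derivative_continuous)

section \<open>Calculus of twice differentiable functions\<close>

lemma twice_diff_add:
  assumes "twice_diff f g T S" "twice_diff f' g' T' S"
  shows "twice_diff (\<lambda>x. f x + f' x) (\<lambda>x. g x + g' x) (\<lambda>x h. T x h + T' x h) S"
  unfolding twice_diff_def
proof (intro ballI conjI)
  fix x assume x: "x \<in> S"
  note D = twice_diffD[OF assms(1) x] twice_diffD[OF assms(2) x]
  show "GDERIV (\<lambda>x. f x + f' x) x :> g x + g' x" using D by (intro GDERIV_add)
  show "((\<lambda>x. g x + g' x) has_derivative (\<lambda>h. T x h + T' x h)) (at x)"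
    using D by (intro has_derivative_add)
  obtain B B' where "\<forall>\<^sub>F y in nhds x. \<forall>h. norm (T y h) \<le> B * norm h"
    "\<forall>\<^sub>F y in nhds x. \<forall>h. norm (T' y h) \<le> B' * norm h" using D by blast
  then have "\<forall>\<^sub>F y in nhds x. \<forall>h. norm (T y h + T' y h) \<le> (B + B') * norm h"
  proof eventually_elim
    case (elim y)
    show ?case
    proof
      fix h
      show "norm (T y h + T' y h) \<le> (B + B') * norm h"
        using norm_triangle_ineq[of "T y h" "T' y h"] elim[THEN spec, of h]
        by (simp add: algebra_simps)
    qed
  qed
  then show "\<exists>B. \<forall>\<^sub>F y in nhds x. \<forall>h. norm (T y h + T' y h) \<le> B * norm h" by blast
qed

lemma twice_diff_scale:
  assumes "twice_diff f g T S"
  shows "twice_diff (\<lambda>x. c * f x) (\<lambda>x. c *\<^sub>R g x) (\<lambda>x h. c *\<^sub>R T x h) S"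
  unfolding twice_diff_def
proof (intro ballI conjI)
  fix x assume x: "x \<in> S"
  note D = twice_diffD[OF assms(1) x]
  show "GDERIV (\<lambda>x. c * f x) x :> c *\<^sub>R g x"
    using has_derivative_mult_right[OF D(1)[unfolded gderiv_def], of c] by (simp add: gderiv_def)
  show "((\<lambda>x. c *\<^sub>R g x) has_derivative (\<lambda>h. c *\<^sub>R T x h)) (at x)"
    using D by (intro has_derivative_scaleR_right)
  obtain B where "\<forall>\<^sub>F y in nhds x. \<forall>h. norm (T y h) \<le> B * norm h" using D by blast
  then have "\<forall>\<^sub>F y in nhds x. \<forall>h. norm (c *\<^sub>R T y h) \<le> (\<bar>c\<bar> * B) * norm h"
    by eventually_elim (simp add: mult.assoc mult_left_mono)
  then show "\<exists>B. \<forall>\<^sub>F y in nhds x. \<forall>h. norm (c *\<^sub>R T y h) \<le> B * norm h" by blast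
qed

lemma twice_diff_norm2: "twice_diff (\<lambda>x. (x - a) \<bullet> (x - a)) (\<lambda>x. 2 *\<^sub>R (x - a)) (\<lambda>x h. 2 *\<^sub>R h) S"
  unfolding twice_diff_def gderiv_def
  by (auto intro!: derivative_eq_intros exI[of _ 2] simp: inner_simps inner_commute fun_eq_iff)

lemma twice_diff_inner: "twice_diff (\<lambda>x. a \<bullet> x) (\<lambda>x. a) (\<lambda>x h. 0) S"
  unfolding twice_diff_def gderiv_def
  by (auto intro!: derivative_eq_intros exI[of _ 0] simp: inner_commute)

text \<open>The Hessian of an exponential barrier contains such a rank-one term, with
  \<open>q\<close> the gradient of the function in the exponent.\<close>

lemma curv_op_rank_one:
  fixes p q :: "'a::euclidean_space"
  shows "curv_op p (\<lambda>h. (q \<bullet> h) *\<^sub>R q) = (q \<bullet> q - (sgn p \<bullet> q)\<^sup>2) / norm p"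
  by (simp add: curv_op_def trace_op_def euclidean_inner[of q q] power2_eq_square inner_commute)

text \<open>The numerator is the squared length of the component of \<open>q\<close> orthogonal to
  \<open>p\<close>.\<close>

lemma curv_op_rank_one_pos:
  fixes p q :: "'a::euclidean_space"
  assumes p: "p \<noteq> 0" and q: "\<nexists>\<mu>. q = \<mu> *\<^sub>R p"
  shows "(q \<bullet> q - (sgn p \<bullet> q)\<^sup>2) / norm p > 0"
proof -
  define s where "s = q - (sgn p \<bullet> q) *\<^sub>R sgn p"
  have "(sgn p \<bullet> q) *\<^sub>R sgn p = ((sgn p \<bullet> q) / norm p) *\<^sub>R p"
    by (simp add: sgn_div_norm divide_inverse_commute)
  then have "s \<noteq> 0" using q by (auto simp: s_def)
  moreover have "sgn p \<bullet> sgn p = 1" using p by (simp add: norm_sgn flip: power2_norm_eq_inner)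
  then have "s \<bullet> s = q \<bullet> q - (sgn p \<bullet> q)\<^sup>2"
    by (simp add: s_def inner_simps power2_eq_square inner_commute)
  ultimately show ?thesis using p by (metis divide_pos_pos inner_gt_zero_iff zero_less_norm_iff)
qed

text \<open>A Hopf lemma on a full ball about the touching point. If the gradients were not
  parallel, the rank-one term of the barrier would dominate all other terms, and
  \<open>u - v\<close> minus a small multiple of the barrier would have an interior minimum that
  contradicts ellipticity. The two nonlinear operators are compared directly at this
  minimum.\<close>

lemma touching_gradient:
  fixes u v \<phi> :: "'a::euclidean_space \<Rightarrow> real"
  assumes U: "open U" and u: "twice_diff u gu Tu U" and v: "twice_diff v gv Tv U"
    and phi: "twice_diff \<phi> g\<phi> T\<phi> U" and F: "continuous_on U F"
    and nzu: "\<And>y. y \<in> U \<Longrightarrow> gu y + F y \<noteq> 0" and nzv: "\<And>y. y \<in> U \<Longrightarrow> gv y + F y \<noteq> 0"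
    and curv: "\<And>y. y \<in> U \<Longrightarrow> curv_op (gu y + F y) (Tu y) \<le> curv_op (gv y + F y) (Tv y)"
    and ge: "\<And>y. y \<in> U \<Longrightarrow> v y \<le> u y"
    and x: "x \<in> U" "u x = v x"
    and r: "r > 0" "\<And>y. y \<in> ball x r \<Longrightarrow> y \<in> U \<Longrightarrow> u y = v y \<Longrightarrow> \<phi> x \<le> \<phi> y"
  shows "\<exists>\<mu>. g\<phi> x = \<mu> *\<^sub>R (gu x + F x)"
proof (rule ccontr)
  assume npar: "\<not> ?thesis"
  \<comment> \<open>\<open>x\<close> is a strict minimum of \<open>\<psi>\<close> on the contact set\<close>
  define \<psi> where "\<psi> y = \<phi> y + (y - x) \<bullet> (y - x)" for y
  define g\<psi> where "g\<psi> y = g\<phi> y + 2 *\<^sub>R (y - x)" for y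
  define T\<psi> where "T\<psi> y h = T\<phi> y h + 2 *\<^sub>R h" for y h
  define \<alpha> where "\<alpha> y = gu y + F y" for y
  define \<beta> where "\<beta> y = gv y + F y" for y
  \<comment> \<open>By \<open>curv_op_rank_one\<close>, this is \<open>curv_op\<close> of the
    rank-one Hessian term of the barrier. Its positivity at \<open>x\<close> is where the assumed
    non-parallelism enters.\<close>
  define E where "E y = (g\<psi> y \<bullet> g\<psi> y - (sgn (\<alpha> y) \<bullet> g\<psi> y)\<^sup>2) / norm (\<alpha> y)" for y
  have psi: "twice_diff \<psi> g\<psi> T\<psi> U"
    unfolding \<psi>_def g\<psi>_def T\<psi>_def by (intro twice_diff_add phi twice_diff_norm2)
  have psix: "\<psi> x = \<phi> x" "g\<psi> x = g\<phi> x" by (simp_all add: \<psi>_def g\<psi>_def)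
  have a0: "\<alpha> x \<noteq> 0" and b0: "\<beta> x \<noteq> 0" using nzu nzv x by (auto simp: \<alpha>_def \<beta>_def)
  have Fx: "isCont F x" using F U x continuous_on_eq_continuous_at by blast
  have ca: "isCont \<alpha> x" "isCont \<beta> x"
    unfolding \<alpha>_def \<beta>_def using Fx twice_diffD(5)[OF u x(1)] twice_diffD(5)[OF v x(1)]
    by (auto intro!: continuous_intros)
  have cg: "isCont g\<psi> x" using twice_diffD(5)[OF psi x(1)] .
  have cE: "isCont E x"
    unfolding E_def using ca cg a0 by (intro continuous_intros) (auto simp: continuous_at sgn_div_norm intro!: tendsto_intros)
  have Ex: "E x > 0"
    unfolding E_def using curv_op_rank_one_pos[OF a0, of "g\<phi> x"] npar by (simp add: psix \<alpha>_def)
  define \<delta> where "\<delta> = min (norm (\<alpha> x)) (norm (\<beta> x)) / 2"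
  define \<eta> where "\<eta> = E x / 2"
  define C2 where "C2 = norm (g\<psi> x) + 1"
  have d: "\<delta> > 0" and \<eta>: "\<eta> > 0" using a0 b0 Ex by (auto simp: \<delta>_def \<eta>_def)
  have dlt: "\<delta> < norm (\<alpha> x)" "\<delta> < norm (\<beta> x)"
    using zero_less_norm_iff[THEN iffD2, OF a0] zero_less_norm_iff[THEN iffD2, OF b0]
    unfolding \<delta>_def by linarith+
  have lim: "(f \<longlongrightarrow> f x) (nhds x)" if "isCont f x" for f :: "'a \<Rightarrow> 'b::topological_space"
    using that by (simp add: isCont_def tendsto_at_iff_tendsto_nhds)
  obtain B1 where B1: "\<forall>\<^sub>F y in nhds x. \<forall>h. norm (T\<psi> y h) \<le> B1 * norm h"
    using twice_diffD(6)[OF psi x(1)] by blast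
  obtain B2 where B2: "\<forall>\<^sub>F y in nhds x. \<forall>h. norm (Tv y h) \<le> B2 * norm h"
    using twice_diffD(6)[OF v x(1)] by blast
  have "\<forall>\<^sub>F y in nhds x. \<delta> < norm (\<alpha> y)"
    by (intro order_tendstoD(1)[OF tendsto_norm[OF lim[OF ca(1)]]] dlt)
  moreover have "\<forall>\<^sub>F y in nhds x. \<delta> < norm (\<beta> y)"
    by (intro order_tendstoD(1)[OF tendsto_norm[OF lim[OF ca(2)]]] dlt)
  moreover have "\<forall>\<^sub>F y in nhds x. \<eta> < E y"
    using Ex by (intro order_tendstoD(1)[OF lim[OF cE]]) (auto simp: \<eta>_def)
  moreover have "\<forall>\<^sub>F y in nhds x. norm (g\<psi> y) < C2"
    by (intro order_tendstoD(2)[OF tendsto_norm[OF lim[OF cg]]]) (auto simp: C2_def)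
  moreover have "\<forall>\<^sub>F y in nhds x. y \<in> U" using U x(1) by (rule eventually_nhds_in_open)
  moreover have "\<forall>\<^sub>F y in nhds x. y \<in> ball x r" using r by (intro eventually_nhds_in_open) auto
  ultimately have "\<forall>\<^sub>F y in nhds x. y \<in> U \<and> y \<in> ball x r \<and> \<delta> < norm (\<alpha> y) \<and> \<delta> < norm (\<beta> y) \<and>
      \<eta> < E y \<and> norm (g\<psi> y) < C2 \<and> (\<forall>h. norm (T\<psi> y h) \<le> B1 * norm h) \<and>
      (\<forall>h. norm (Tv y h) \<le> B2 * norm h)"
    using B1 B2 by eventually_elim auto
  then obtain \<rho>' where \<rho>': "\<rho>' > 0" and near': "\<And>y. dist y x < \<rho>' \<Longrightarrow> y \<in> U \<and> y \<in> ball x r \<and> \<delta> < norm (\<alpha> y) \<and> \<delta> < norm (\<beta> y) \<and>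
      \<eta> < E y \<and> norm (g\<psi> y) < C2 \<and> (\<forall>h. norm (T\<psi> y h) \<le> B1 * norm h) \<and>
      (\<forall>h. norm (Tv y h) \<le> B2 * norm h)"
    unfolding eventually_nhds_metric by blast
  \<comment> \<open>Halving the radius carries the bounds over to a closed ball, on which minima are
    attained.\<close>
  define \<rho> where "\<rho> = \<rho>' / 2"
  have \<rho>: "\<rho> > 0" using \<rho>' by (simp add: \<rho>_def)
  have near: "y \<in> U" "y \<in> ball x r" "\<delta> \<le> norm (\<alpha> y)" "\<delta> \<le> norm (\<beta> y)" "\<eta> \<le> E y" "norm (g\<psi> y) \<le> C2"
    "\<And>h. norm (T\<psi> y h) \<le> B1 * norm h" "\<And>h. norm (Tv y h) \<le> B2 * norm h" if "y \<in> cball x \<rho>" for y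
    using near'[of y] that \<rho>' by (auto simp: \<rho>_def dist_commute less_imp_le)
  \<comment> \<open>\<open>C1\<close> bounds the contribution of \<open>T\<psi>\<close>, and
    \<open>C3\<close> is the Lipschitz constant of the operator with \<open>Tv\<close>. The
    parameter \<open>k\<close> below makes \<open>k * \<eta>\<close> exceed the total of these
    errors.\<close>
  define C1 where "C1 = (DIM('a) + 1) * B1 / \<delta>"
  define C3 where "C3 = (DIM('a) + 5) * B2 / \<delta>\<^sup>2"
  have C3: "C3 \<ge> 0"
    using bound_nonneg[of "Tv x" B2] near(8)[of x] \<rho> by (auto simp: C3_def)
  define k where "k = (\<bar>C1 + C3 * C2\<bar> + 1) / \<eta>"
  have k: "k > 0" "k * \<eta> > C1 + C3 * C2" using \<eta> by (auto simp: k_def)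
  \<comment> \<open>Hopf barrier: a strict subsolution for large \<open>k\<close>, vanishing at \<open>x\<close> and negative where \<open>\<psi> > \<psi> x\<close>\<close>
  define ex where "ex y = exp (- k * (\<psi> y - \<psi> x))" for y
  define h where "h y = ex y - 1" for y
  define gh where "gh y = (- k * ex y) *\<^sub>R g\<psi> y" for y
  \<comment> \<open>The Hessian of \<open>h\<close>: the rank-one term carries \<open>k\<close>
    squared, \<open>T\<psi>\<close> only one factor \<open>k\<close>.\<close>
  define Th where "Th y z = (ex y * k) *\<^sub>R (k *\<^sub>R (g\<psi> y \<bullet> z) *\<^sub>R g\<psi> y - T\<psi> y z)" for y z
  have dex: "(ex has_derivative (\<lambda>z. z \<bullet> gh y)) (at y)" if "y \<in> U" for y
    unfolding ex_def gh_def using twice_diffD(1)[OF psi that]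
    by (auto simp: gderiv_def intro!: derivative_eq_intros)
  have dh: "GDERIV h y :> gh y" if "y \<in> U" for y
    unfolding h_def gderiv_def using has_derivative_diff[OF dex[OF that] has_derivative_const[of 1]] by simp
  have dgh: "(gh has_derivative Th y) (at y)" if "y \<in> U" for y
  proof -
    have "(gh has_derivative (\<lambda>z. (- k * ex y) *\<^sub>R T\<psi> y z + (- k * (z \<bullet> gh y)) *\<^sub>R g\<psi> y)) (at y)"
      unfolding gh_def using dex[OF that, unfolded gh_def] twice_diffD(2)[OF psi that]
      by (intro has_derivative_scaleR has_derivative_mult_right)
    also have "(\<lambda>z. (- k * ex y) *\<^sub>R T\<psi> y z + (- k * (z \<bullet> gh y)) *\<^sub>R g\<psi> y) = Th y"
      by (simp add: Th_def gh_def fun_eq_iff algebra_simps inner_commute)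
    finally show ?thesis .
  qed
  define w where "w y = u y - v y" for y
  have w0: "w y \<ge> 0" if "y \<in> U" for y using ge[OF that] by (simp add: w_def)
  have sub: "cball x \<rho> \<subseteq> U" using near by auto
  have cont: "continuous_on (cball x \<rho>) w" "continuous_on (cball x \<rho>) h" "continuous_on (cball x \<rho>) \<psi>"
    using twice_diffD(4)[OF u] twice_diffD(4)[OF v] twice_diffD(4)[OF psi]
      has_derivative_continuous[OF dh[unfolded gderiv_def]] sub
    by (auto simp: w_def subset_iff intro!: continuous_intros continuous_at_imp_continuous_on)
  \<comment> \<open>Only on this part of the sphere can \<open>h\<close> be positive, and there
    \<open>w\<close> is bounded away from 0, as \<open>x\<close> is a strict minimum of
    \<open>\<psi>\<close> on the contact set.\<close>
  define S where "S = {y \<in> sphere x \<rho>. \<psi> y \<le> \<psi> x}"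
  have S: "S \<subseteq> cball x \<rho>" by (auto simp: S_def)
  have "compact S"
  proof -
    have "closed {y \<in> sphere x \<rho>. \<psi> y \<le> \<psi> x}"
      by (intro continuous_on_closed_Collect_le continuous_on_subset[OF cont(3)]) auto
    then show ?thesis
      unfolding S_def by (metis (no_types, lifting) bounded_sphere bounded_subset compact_eq_bounded_closed mem_Collect_eq subsetI)
  qed
  have wS: "w y > 0" if "y \<in> S" for y
  proof -
    have y: "y \<in> cball x \<rho>" "y \<noteq> x" "\<psi> y \<le> \<psi> x" using that \<rho> by (auto simp: S_def)
    have "(y - x) \<bullet> (y - x) > 0" using y by simp
    then have "\<phi> y < \<phi> x" using y(3) unfolding psix(1) unfolding \<psi>_def by linarith
    then have "u y \<noteq> v y" using r(2)[of y] near(1,2)[OF y(1)] by force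
    then show ?thesis using ge[of y] near(1)[OF y(1)] by (simp add: w_def)
  qed
  obtain \<epsilon> where e: "\<epsilon> > 0" "\<And>y. y \<in> S \<Longrightarrow> \<epsilon> * h y \<le> w y"
  proof (cases "S = {}")
    case True
    then show ?thesis using that[of 1] by auto
  next
    case False
    obtain y1 where y1: "y1 \<in> S" "\<And>y. y \<in> S \<Longrightarrow> w y1 \<le> w y"
      using continuous_attains_inf[OF \<open>compact S\<close> False] cont(1) S continuous_on_subset by metis
    obtain y2 where y2: "y2 \<in> S" "\<And>y. y \<in> S \<Longrightarrow> h y \<le> h y2"
      using continuous_attains_sup[OF \<open>compact S\<close> False] cont(2) S continuous_on_subset by metis
    \<comment> \<open>The added 1 keeps the denominator positive and covers every sign of
      \<open>h y2\<close>.\<close>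
    define \<epsilon> where "\<epsilon> = w y1 / (\<bar>h y2\<bar> + 1)"
    have \<epsilon>: "\<epsilon> > 0" using wS[OF y1(1)] by (simp add: \<epsilon>_def)
    have "\<epsilon> * h y \<le> w y" if "y \<in> S" for y
    proof -
      have "\<epsilon> * h y \<le> \<epsilon> * (\<bar>h y2\<bar> + 1)" using \<epsilon> y2(2)[OF that] by (intro mult_left_mono) auto
      also have "\<dots> = w y1" by (simp add: \<epsilon>_def)
      finally show ?thesis using y1(2)[OF that] by simp
    qed
    then show ?thesis using that \<epsilon> by blast
  qed
  define G where "G y = w y - \<epsilon> * h y" for y
  have Gx: "G x = 0" using x by (simp add: G_def w_def h_def ex_def)
  have Gsph: "G y \<ge> 0" if "y \<in> sphere x \<rho>" for y
  proof (cases "\<psi> y \<le> \<psi> x")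
    case True
    then show ?thesis using e(2)[of y] that by (simp add: S_def G_def)
  next
    case False
    then have "h y \<le> 0" using k by (simp add: h_def ex_def)
    then have "\<epsilon> * h y \<le> 0" using e by (simp add: mult_nonneg_nonpos)
    moreover have "w y \<ge> 0" using that sub by (intro w0) auto
    ultimately show ?thesis by (simp add: G_def)
  qed
  have "continuous_on (cball x \<rho>) G" unfolding G_def by (intro continuous_intros cont)
  then obtain y1 where y1: "y1 \<in> cball x \<rho>" "\<And>y. y \<in> cball x \<rho> \<Longrightarrow> G y1 \<le> G y"
    using continuous_attains_inf[of "cball x \<rho>" G] \<rho> by auto
  \<comment> \<open>A negative minimum cannot lie on the sphere; if there is none, \<open>x\<close>
    itself, where \<open>G\<close> vanishes, is a minimum in the open ball.\<close>
  obtain y where y: "y \<in> ball x \<rho>" "\<And>z. z \<in> ball x \<rho> \<Longrightarrow> G y \<le> G z"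
  proof (cases "G y1 < 0")
    case True
    then show ?thesis using that[of y1] y1 Gsph[of y1] by force
  next
    case False
    then have "G x \<le> G z" if "z \<in> ball x \<rho>" for z
      using y1(2)[of z] Gx that by auto
    then show ?thesis using that[of x] \<rho> by auto
  qed
  define gG where "gG z = (gu z - gv z) - \<epsilon> *\<^sub>R gh z" for z
  have yc: "y \<in> cball x \<rho>" and yU: "y \<in> U" using y(1) sub by auto
  have dG: "GDERIV G z :> gG z" if "z \<in> ball x \<rho>" for z
  proof -
    have "z \<in> U" using that sub by auto
    then show ?thesis unfolding G_def w_def gG_def
      using twice_diffD(1)[OF u] twice_diffD(1)[OF v] dh
      by (auto simp: gderiv_def inner_simps intro!: derivative_eq_intros)
  qed
  define TG where "TG z = (Tu y z - Tv y z) - \<epsilon> *\<^sub>R Th y z" for z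
  have dgG: "(gG has_derivative TG) (at y)"
    unfolding gG_def TG_def using twice_diffD(2)[OF u yU] twice_diffD(2)[OF v yU] dgh[OF yU]
    by (intro derivative_intros)
  note crit = interior_min_second_order[OF open_ball y(1) dG dgG y(2)]
  have lin: "linear (Tu y)" "linear (Tv y)" "linear (Th y)" "linear (T\<psi> y)"
    using twice_diffD(3) u v psi yU has_derivative_linear[OF dgh[OF yU]] by auto
  have ay: "\<alpha> y \<noteq> 0" using nzu[OF yU] by (simp add: \<alpha>_def)
  have lin2: "linear (\<lambda>z. Tu y z - Tv y z)" "linear (\<lambda>z. \<epsilon> *\<^sub>R Th y z)"
    using lin by (auto intro: linear_compose_sub linear_compose_scale_right)
  have "0 \<le> curv_op (\<alpha> y) TG"
    by (rule curv_op_nonneg[OF has_derivative_linear[OF dgG] _ ay]) (use crit(2) in blast)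
  also have "\<dots> = curv_op (\<alpha> y) (Tu y) - curv_op (\<alpha> y) (Tv y) - \<epsilon> * curv_op (\<alpha> y) (Th y)"
    unfolding TG_def by (simp add: curv_op_diff lin lin2 curv_op_scale)
  finally have 1: "curv_op (\<alpha> y) (Tv y) + \<epsilon> * curv_op (\<alpha> y) (Th y) \<le> curv_op (\<beta> y) (Tv y)"
    using curv[OF yU] by (simp add: \<alpha>_def \<beta>_def)
  have ey: "ex y > 0" by (simp add: ex_def)
  \<comment> \<open>The critical point equation for \<open>G\<close>. The two operators are thus
    evaluated at vectors that differ by one factor \<open>k\<close>, while the barrier gains
    two.\<close>
  have "\<alpha> y - \<beta> y = \<epsilon> *\<^sub>R gh y" using crit(1) by (simp add: gG_def \<alpha>_def \<beta>_def algebra_simps)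
  then have "norm (\<alpha> y - \<beta> y) = \<epsilon> * (k * ex y * norm (g\<psi> y))"
    using e k ey by (simp add: gh_def abs_mult)
  also have "\<dots> \<le> \<epsilon> * (k * ex y * C2)" using e k ey near(6)[OF yc] by (intro mult_left_mono) auto
  finally have ab: "norm (\<alpha> y - \<beta> y) \<le> \<epsilon> * (k * ex y * C2)" .
  have "\<bar>curv_op (\<alpha> y) (Tv y) - curv_op (\<beta> y) (Tv y)\<bar> \<le> C3 * norm (\<alpha> y - \<beta> y)"
    unfolding C3_def using near[OF yc] lin d by (intro curv_op_lipschitz) auto
  also have "\<dots> \<le> C3 * (\<epsilon> * (k * ex y * C2))" using ab C3 by (rule mult_left_mono)
  finally have 2: "curv_op (\<beta> y) (Tv y) - curv_op (\<alpha> y) (Tv y) \<le> C3 * (\<epsilon> * (k * ex y * C2))" by simp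
  have lin3: "linear (\<lambda>z. (g\<psi> y \<bullet> z) *\<^sub>R g\<psi> y)"
    by (intro linearI) (auto simp: inner_simps algebra_simps)
  have "curv_op (\<alpha> y) (Th y) = (ex y * k) * (k * E y - curv_op (\<alpha> y) (T\<psi> y))"
    unfolding Th_def E_def curv_op_scale
      curv_op_diff[OF linear_compose_scale_right[OF lin3, of k] lin(4)] curv_op_rank_one ..
  also have "\<dots> \<ge> (ex y * k) * (k * \<eta> - C1)"
    using near(5)[OF yc] abs_curv_op_le[of "T\<psi> y" B1 \<delta> "\<alpha> y"] near[OF yc] d k ey
    by (intro mult_left_mono diff_mono) (auto simp: C1_def)
  finally have "\<epsilon> * ((ex y * k) * (k * \<eta> - C1)) \<le> \<epsilon> * curv_op (\<alpha> y) (Th y)"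
    using e by (intro mult_left_mono) auto
  with 1 2 have "\<epsilon> * ((ex y * k) * (k * \<eta> - C1)) \<le> C3 * (\<epsilon> * (k * ex y * C2))" by linarith
  then have "(\<epsilon> * ex y * k) * (k * \<eta> - C1 - C3 * C2) \<le> 0" by (simp add: algebra_simps)
  moreover have "\<epsilon> * ex y * k > 0" "k * \<eta> - C1 - C3 * C2 > 0" using e ey k by auto
  ultimately show False using mult_pos_pos by (metis not_le)
qed

section \<open>Propagation of the contact set\<close>

text \<open>The mean value inequality is used twice: the bounded Hessian makes \<open>g\<close>
  Lipschitz, and then \<open>u z - z \<bullet> g x\<close> has a small gradient.\<close>

lemma twice_diff_taylor:
  fixes u :: "'a::euclidean_space \<Rightarrow> real"
  assumes U: "open U" and u: "twice_diff u g T U" and x: "x \<in> U"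
  obtains r B where "r > 0" "cball x r \<subseteq> U" "B \<ge> 0"
    "\<And>y. y \<in> cball x r \<Longrightarrow> \<bar>u y - u x - (y - x) \<bullet> g x\<bar> \<le> B * (norm (y - x))\<^sup>2"
proof -
  obtain B where "\<forall>\<^sub>F y in nhds x. \<forall>h. norm (T y h) \<le> B * norm h"
    using twice_diffD(6)[OF u x] by blast
  with eventually_nhds_in_open[OF U x]
  have "\<forall>\<^sub>F y in nhds x. y \<in> U \<and> (\<forall>h. norm (T y h) \<le> B * norm h)"
    by eventually_elim auto
  then obtain r' where r': "r' > 0" "\<And>y. dist y x < r' \<Longrightarrow> y \<in> U \<and> (\<forall>h. norm (T y h) \<le> B * norm h)"
    unfolding eventually_nhds_metric by blast
  define r where "r = r' / 2"
  have r: "r > 0" using r' by (simp add: r_def)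
  have near: "y \<in> U" "\<And>h. norm (T y h) \<le> B * norm h" if "y \<in> cball x r" for y
    using r'(2)[of y] that r'(1) by (auto simp: r_def dist_commute)
  have B: "B \<ge> 0" using bound_nonneg[of "T x" B] near(2)[of x] r by auto
  have lip: "norm (g y - g x) \<le> B * norm (y - x)" if "y \<in> cball x r" for y
  proof (rule differentiable_bound[OF convex_cball _ _ that])
    show "(g has_derivative T z) (at z within cball x r)" if "z \<in> cball x r" for z
      using twice_diffD(2)[OF u near(1)[OF that]] by (rule has_derivative_at_withinI)
    show "onorm (T z) \<le> B" if "z \<in> cball x r" for z
      using near(2)[OF that] by (intro onorm_bound B)
  qed (use r in auto)
  have "\<bar>u y - u x - (y - x) \<bullet> g x\<bar> \<le> B * (norm (y - x))\<^sup>2" if y: "y \<in> cball x r" for y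
  proof -
    define f where "f z = u z - z \<bullet> g x" for z
    \<comment> \<open>On this smaller ball the gradient of \<open>f\<close> is at most
      \<open>B * norm (y - x)\<close>, which yields the quadratic bound.\<close>
    have sub: "cball x (dist x y) \<subseteq> cball x r" using y by auto
    have "norm (f y - f x) \<le> (B * norm (y - x)) * norm (y - x)"
    proof (rule differentiable_bound[OF convex_cball[of x "dist x y"]])
      show "(f has_derivative (\<lambda>h. h \<bullet> (g z - g x))) (at z within cball x (dist x y))"
        if "z \<in> cball x (dist x y)" for z
      proof -
        have "(u has_derivative (\<lambda>h. h \<bullet> g z)) (at z)"
          using twice_diffD(1)[OF u near(1)] that sub by (auto simp: gderiv_def)
        then have "(f has_derivative (\<lambda>h. h \<bullet> g z - h \<bullet> g x)) (at z)"
          unfolding f_def by (intro derivative_intros)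
        then show ?thesis by (simp add: inner_diff_right has_derivative_at_withinI)
      qed
      show "onorm (\<lambda>h. h \<bullet> (g z - g x)) \<le> B * norm (y - x)" if z: "z \<in> cball x (dist x y)" for z
      proof (rule onorm_bound)
        show "B * norm (y - x) \<ge> 0" using B by simp
        fix h
        have "norm (h \<bullet> (g z - g x)) \<le> norm h * norm (g z - g x)"
          using Cauchy_Schwarz_ineq2 by auto
        also have "\<dots> \<le> norm h * (B * norm (z - x))"
          using z sub by (intro mult_left_mono lip) auto
        also have "\<dots> \<le> norm h * (B * norm (y - x))"
          using z B by (intro mult_left_mono) (auto simp: dist_norm norm_minus_commute)
        finally show "norm (h \<bullet> (g z - g x)) \<le> B * norm (y - x) * norm h"
          by (simp add: algebra_simps)
      qed
    qed auto
    then show ?thesis by (simp add: f_def inner_diff_left power2_eq_square algebra_simps)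
  qed
  with that r B near(1) show thesis by blast
qed

section \<open>Skew complex structures\<close>

lemma skew_inner:
  assumes J: "linear J" and sk: "\<And>h. J h \<bullet> h = 0"
  shows "J h \<bullet> k = - (h \<bullet> J k)"
  using sk[of "h + k"] sk[of h] sk[of k]
  by (simp add: linear_add[OF J] inner_simps inner_commute)

lemma complex_structure_norm:
  assumes J: "linear J" and sk: "\<And>h. J h \<bullet> h = 0" and JJ: "\<And>h. J (J h) = - h"
  shows "norm (J h) = norm h"
  using skew_inner[OF J sk, of h "J h"] by (simp add: JJ norm_eq_sqrt_inner)

text \<open>Pairing the equation with \<open>e\<close> removes \<open>J\<close>, and taking squared
  lengths removes the cross term. Eliminating \<open>\<nu>\<close> bounds \<open>e\<close> by its
  component along \<open>a\<close>; the factor 2 is a crude bound obtained from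
  \<open>\<tau> \<ge> 1\<close>.\<close>

lemma complex_structure_resolvent_bound:
  fixes J :: "'a::euclidean_space \<Rightarrow> 'a"
  assumes J: "linear J" and sk: "\<And>h. J h \<bullet> h = 0" and JJ: "\<And>h. J (J h) = - h"
    and \<tau>: "\<tau> \<ge> 1" and s: "\<bar>s\<bar> = 1" and eq: "\<tau> *\<^sub>R e - s *\<^sub>R J e = \<nu> *\<^sub>R a"
  shows "norm e * norm a \<le> 2 * \<bar>a \<bullet> e\<bar>"
proof (cases "e = 0")
  case False
  have s2: "s * s = 1" using s by (simp add: abs_if split: if_splits)
  have "(\<tau> *\<^sub>R e - s *\<^sub>R J e) \<bullet> e = \<tau> * (e \<bullet> e)" using sk[of e] by (simp add: inner_simps)
  then have 1: "\<nu> * (a \<bullet> e) = \<tau> * (e \<bullet> e)" using eq by simp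
  have JeJe: "J e \<bullet> J e = e \<bullet> e"
    using complex_structure_norm[OF J sk JJ, of e] by (simp flip: power2_norm_eq_inner)
  have "(\<tau> *\<^sub>R e - s *\<^sub>R J e) \<bullet> (\<tau> *\<^sub>R e - s *\<^sub>R J e) = (\<tau>\<^sup>2 + s * s) * (e \<bullet> e)"
    using sk[of e] JeJe by (simp add: inner_simps inner_commute[of e "J e"] power2_eq_square algebra_simps)
  then have 2: "\<nu>\<^sup>2 * (a \<bullet> a) = (\<tau>\<^sup>2 + 1) * (e \<bullet> e)"
    using eq s2 by (simp add: power2_eq_square algebra_simps)
  have ee: "e \<bullet> e > 0" using False by simp
  have \<nu>: "\<nu> \<noteq> 0" using 2 ee \<tau> by (auto simp: add_nonneg_eq_0_iff)
  have "\<tau>\<^sup>2 * ((e \<bullet> e) * (a \<bullet> a)) * (e \<bullet> e) = (\<nu> * (a \<bullet> e))\<^sup>2 * (a \<bullet> a)"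
    unfolding 1 by (simp add: power2_eq_square algebra_simps)
  also have "\<dots> = (a \<bullet> e)\<^sup>2 * (\<nu>\<^sup>2 * (a \<bullet> a))" by (simp add: power2_eq_square algebra_simps)
  also have "\<dots> = (a \<bullet> e)\<^sup>2 * (\<tau>\<^sup>2 + 1) * (e \<bullet> e)" unfolding 2 by simp
  finally have 3: "\<tau>\<^sup>2 * ((e \<bullet> e) * (a \<bullet> a)) = (a \<bullet> e)\<^sup>2 * (\<tau>\<^sup>2 + 1)" using ee by simp
  have t1: "\<tau>\<^sup>2 \<ge> 1" using \<tau> by (simp add: one_le_power)
  have "\<tau>\<^sup>2 * ((e \<bullet> e) * (a \<bullet> a)) \<le> (a \<bullet> e)\<^sup>2 * (4 * \<tau>\<^sup>2)"
    unfolding 3 using t1 by (intro mult_left_mono) auto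
  then have "\<tau>\<^sup>2 * ((e \<bullet> e) * (a \<bullet> a)) \<le> \<tau>\<^sup>2 * (4 * (a \<bullet> e)\<^sup>2)" by (simp add: algebra_simps)
  then have "(e \<bullet> e) * (a \<bullet> a) \<le> 4 * (a \<bullet> e)\<^sup>2" using t1 by (subst (asm) mult_le_cancel_left_pos) auto
  then have "(norm e * norm a)\<^sup>2 \<le> (2 * \<bar>a \<bullet> e\<bar>)\<^sup>2"
    by (simp add: power_mult_distrib power2_norm_eq_inner)
  then show ?thesis by (rule power2_le_imp_le) simp
qed simp

text \<open>Comparison with the value at \<open>x\<close> shows first that the minimiser
  \<open>y\<close> is within \<open>K * \<epsilon>\<close> of \<open>x\<close>, then that
  \<open>a \<bullet> (y - x)\<close> is quadratic in \<open>\<epsilon>\<close>. Hence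
  \<open>y\<close> is an interior minimiser and \<open>touch\<close> applies; the resolvent bound
  makes \<open>y\<close> minus the centre nearly parallel to \<open>a\<close>, and that component is
  already quadratically small because \<open>\<zeta>\<close> is orthogonal to
  \<open>a\<close>.\<close>

lemma penalised_minimiser_near_centre:
  fixes u :: "'a::euclidean_space \<Rightarrow> real" and J :: "'a \<Rightarrow> 'a"
  assumes U: "open U" and u: "twice_diff u g T U"
    and J: "linear J" and sk: "\<And>h. J h \<bullet> h = 0" and JJ: "\<And>h. J (J h) = - h"
    and Z: "closedin (top_of_set U) Z"
    and touch: "\<And>\<phi> g\<phi> T\<phi> x r. twice_diff \<phi> g\<phi> T\<phi> U \<Longrightarrow> x \<in> Z \<Longrightarrow> r > 0 \<Longrightarrow>
        (\<And>y. y \<in> ball x r \<Longrightarrow> y \<in> Z \<Longrightarrow> \<phi> x \<le> \<phi> y) \<Longrightarrow> \<exists>\<mu>. g\<phi> x = \<mu> *\<^sub>R (g x + J x)"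
    and x: "x \<in> Z" and a: "a = g x + J x" "a \<noteq> 0" and s: "\<bar>s\<bar> = (1::real)"
    and c: "c \<ge> 0" "\<rho> > 0" "\<And>y. y \<in> Z \<Longrightarrow> y \<in> ball x \<rho> \<Longrightarrow> s * (a \<bullet> (y - x)) \<ge> - c * (norm (y - x))\<^sup>2"
  obtains \<epsilon>0 \<tau> C Z' where "\<epsilon>0 > 0" "\<tau> > 0" "C \<ge> 0"
    "\<And>\<epsilon> \<zeta>. 0 < \<epsilon> \<Longrightarrow> \<epsilon> < \<epsilon>0 \<Longrightarrow> norm \<zeta> = 1 \<Longrightarrow> a \<bullet> \<zeta> = 0 \<Longrightarrow>
      \<exists>y\<in>Z'. norm (y - (x + \<epsilon> *\<^sub>R \<zeta>)) \<le> C * \<epsilon>\<^sup>2 \<and>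
        (\<forall>y'\<in>Z'. s * (u y + J (x + \<epsilon> *\<^sub>R \<zeta>) \<bullet> y) + \<tau> / 2 * (norm (y - (x + \<epsilon> *\<^sub>R \<zeta>)))\<^sup>2
          \<le> s * (u y' + J (x + \<epsilon> *\<^sub>R \<zeta>) \<bullet> y') + \<tau> / 2 * (norm (y' - (x + \<epsilon> *\<^sub>R \<zeta>)))\<^sup>2)"
proof -
  have ZU: "Z \<subseteq> U" using Z closedin_imp_subset by fastforce
  have xU: "x \<in> U" using x ZU by auto
  define \<alpha> where "\<alpha> y = g y + J y" for y
  obtain r1 B where r1: "r1 > 0" "cball x r1 \<subseteq> U" and B: "B \<ge> 0"
    and taylor: "\<And>y. y \<in> cball x r1 \<Longrightarrow> \<bar>u y - u x - (y - x) \<bullet> g x\<bar> \<le> B * (norm (y - x))\<^sup>2"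
    using twice_diff_taylor[OF U u xU] by metis
  have "isCont \<alpha> x"
    unfolding \<alpha>_def using twice_diffD(5)[OF u xU] linear_continuous_at[of J x] J
    by (intro continuous_intros) (auto simp: linear_conv_bounded_linear)
  \<comment> \<open>The fraction 1/8 is small enough for the error from replacing
    \<open>\<alpha> y\<close> by \<open>a\<close> to be absorbed at the end, at the price of the
    factor 4 in \<open>C\<close>.\<close>
  then have "\<forall>\<^sub>F y in nhds x. dist (\<alpha> y) (\<alpha> x) < norm a / 8"
    using a by (intro tendstoD) (auto simp: isCont_def tendsto_at_iff_tendsto_nhds)
  then obtain r2 where r2: "r2 > 0" "\<And>y. dist y x < r2 \<Longrightarrow> dist (\<alpha> y) (\<alpha> x) < norm a / 8"
    unfolding eventually_nhds_metric by blast
  define r where "r = min r1 (min r2 \<rho>) / 2"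
  have "0 < r" "r < r1" "r < r2" "r < \<rho>" using r1 r2 c by (auto simp: r_def min_def)
  note r = this
  define Z' where "Z' = Z \<inter> cball x r"
  have "compact Z'"
  proof -
    have "cball x r \<subseteq> U" using r1 r by auto
    obtain K where K: "closed K" "Z = U \<inter> K" using Z by (auto simp: closedin_closed)
    have "Z' = cball x r \<inter> K" using K \<open>cball x r \<subseteq> U\<close> by (auto simp: Z'_def)
    then show ?thesis using K compact_Int_closed by auto
  qed
  \<comment> \<open>Half of \<open>\<tau>\<close> absorbs the Taylor error \<open>B\<close> and the
    loss \<open>c\<close> and still leaves one copy of the squared distance. \<open>K\<close> bounds
    the terms linear in \<open>\<epsilon>\<close>: 1 from \<open>J\<close>, \<open>\<tau>\<close>
    from the penalty.\<close>
  define \<tau> where "\<tau> = 2 * (B + c + 1)"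
  define K where "K = 1 + \<tau>"
  define C where "C = 4 * (B + c + 1) * K\<^sup>2 / norm a"
  have \<tau>: "\<tau> \<ge> 1" and K: "K > 0" and C: "C \<ge> 0" using B c by (auto simp: \<tau>_def K_def C_def)
  define \<phi> where "\<phi> z y = s * (u y + J z \<bullet> y) + \<tau> / 2 * (norm (y - z))\<^sup>2" for z y
  have main: "\<exists>y\<in>Z'. norm (y - (x + \<epsilon> *\<^sub>R \<zeta>)) \<le> C * \<epsilon>\<^sup>2 \<and> (\<forall>y'\<in>Z'. \<phi> (x + \<epsilon> *\<^sub>R \<zeta>) y \<le> \<phi> (x + \<epsilon> *\<^sub>R \<zeta>) y')"
    if \<epsilon>: "0 < \<epsilon>" "\<epsilon> < r / K" and \<zeta>: "norm \<zeta> = 1" "a \<bullet> \<zeta> = 0" for \<epsilon> \<zeta>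
  proof -
    define z where "z = x + \<epsilon> *\<^sub>R \<zeta>"
    have phi: "twice_diff (\<phi> z) (\<lambda>y. s *\<^sub>R (g y + J z) + (\<tau> / 2) *\<^sub>R (2 *\<^sub>R (y - z)))
        (\<lambda>y h. s *\<^sub>R (T y h + 0) + (\<tau> / 2) *\<^sub>R (2 *\<^sub>R h)) U"
      unfolding \<phi>_def power2_norm_eq_inner
      by (intro twice_diff_add twice_diff_scale u twice_diff_inner twice_diff_norm2)
    have "continuous_on Z' (\<phi> z)"
      using twice_diffD(4)[OF phi] ZU by (auto simp: Z'_def intro!: continuous_at_imp_continuous_on)
    moreover have xZ': "x \<in> Z'" using x r by (auto simp: Z'_def)
    ultimately obtain y where y: "y \<in> Z'" "\<And>y'. y' \<in> Z' \<Longrightarrow> \<phi> z y \<le> \<phi> z y'"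
      using continuous_attains_inf[OF \<open>compact Z'\<close>] by blast
    define d where "d = y - x"
    define D where "D = norm d"
    have yr: "y \<in> Z" "y \<in> cball x r1" "y \<in> ball x \<rho>" "dist y x < r2" "y \<in> cball x r"
      using y r by (auto simp: Z'_def dist_commute)
    define R where "R = u y - u x - d \<bullet> g x"
    have R: "\<bar>R\<bar> \<le> B * D\<^sup>2" using taylor[OF yr(2)] by (simp add: R_def d_def D_def)
    \<comment> \<open>An exact expansion: the parts \<open>g x\<close> and \<open>J x\<close> of the
      linear term combine to \<open>a\<close>.\<close>
    have diff: "\<phi> z y - \<phi> z x = s * R + s * (a \<bullet> d) + s * \<epsilon> * (J \<zeta> \<bullet> d) + \<tau> / 2 * D\<^sup>2 - \<tau> * \<epsilon> * (\<zeta> \<bullet> d)"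
    proof -
      have "J z = J x + \<epsilon> *\<^sub>R J \<zeta>" by (simp add: z_def linear_add[OF J] linear_cmul[OF J])
      moreover have "y = x + d" by (simp add: d_def)
      ultimately show ?thesis
        unfolding \<phi>_def R_def D_def z_def power2_norm_eq_inner a
        by (simp add: inner_simps inner_commute algebra_simps)
    qed
    have s1: "s = 1 \<or> s = -1" using s by (auto simp: abs_if split: if_splits)
    have J1: "\<bar>J \<zeta> \<bullet> d\<bar> \<le> D" and z1: "\<bar>\<zeta> \<bullet> d\<bar> \<le> D"
      using Cauchy_Schwarz_ineq2[of "J \<zeta>" d] Cauchy_Schwarz_ineq2[of \<zeta> d] \<zeta>
        complex_structure_norm[OF J sk JJ, of \<zeta>] by (simp_all add: D_def)
    have D0: "D \<ge> 0" by (simp add: D_def)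
    have sR: "\<bar>s * R\<bar> \<le> B * D\<^sup>2" using R s by (simp add: abs_mult)
    have "\<bar>s * \<epsilon> * (J \<zeta> \<bullet> d)\<bar> \<le> \<epsilon> * D" using J1 s \<epsilon> by (simp add: abs_mult)
    moreover have "\<bar>\<tau> * \<epsilon> * (\<zeta> \<bullet> d)\<bar> \<le> \<tau> * \<epsilon> * D" using z1 \<tau> \<epsilon> by (simp add: abs_mult)
    ultimately have lin: "\<bar>s * \<epsilon> * (J \<zeta> \<bullet> d)\<bar> + \<bar>\<tau> * \<epsilon> * (\<zeta> \<bullet> d)\<bar> \<le> K * \<epsilon> * D"
      by (simp add: K_def algebra_simps)
    have le0: "\<phi> z y - \<phi> z x \<le> 0" using y(2)[OF xZ'] by simp
    have prox: "s * (a \<bullet> d) \<ge> - c * D\<^sup>2" using c(3)[OF yr(1,3)] by (simp add: d_def D_def)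
    have tD: "\<tau> / 2 * D\<^sup>2 = B * D\<^sup>2 + c * D\<^sup>2 + D\<^sup>2" by (simp add: \<tau>_def algebra_simps)
    have "D\<^sup>2 \<le> K * \<epsilon> * D" using le0 diff sR lin prox tD by linarith
    then have DK: "D \<le> K * \<epsilon>"
      using D0 K \<epsilon> by (cases "D = 0") (auto simp: power2_eq_square)
    have D2: "D\<^sup>2 \<le> K\<^sup>2 * \<epsilon>\<^sup>2" using power_mono[OF DK D0, of 2] by (simp add: power_mult_distrib)
    have KD: "K * \<epsilon> * D \<le> K\<^sup>2 * \<epsilon>\<^sup>2"
      using mult_left_mono[OF DK, of "K * \<epsilon>"] K \<epsilon> by (simp add: power2_eq_square algebra_simps)
    have "s * (a \<bullet> d) \<le> K * \<epsilon> * D"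
    proof -
      have "0 \<le> c * D\<^sup>2" using c by simp
      moreover have "0 \<le> D\<^sup>2" by simp
      ultimately show ?thesis using le0 diff sR lin tD by linarith
    qed
    then have up: "s * (a \<bullet> d) \<le> (B + c + 1) * (K\<^sup>2 * \<epsilon>\<^sup>2)"
      using KD B c by (smt (verit) mult_le_cancel_right1 mult_nonneg_nonneg zero_le_power2)
    have "c * D\<^sup>2 \<le> c * (K\<^sup>2 * \<epsilon>\<^sup>2)" using D2 c by (intro mult_left_mono)
    also have "\<dots> \<le> (B + c + 1) * (K\<^sup>2 * \<epsilon>\<^sup>2)" using B by (intro mult_right_mono) auto
    finally have "\<bar>s * (a \<bullet> d)\<bar> \<le> (B + c + 1) * (K\<^sup>2 * \<epsilon>\<^sup>2)" using up prox by linarith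
    then have ad: "\<bar>a \<bullet> d\<bar> \<le> (B + c + 1) * (K\<^sup>2 * \<epsilon>\<^sup>2)" using s by (simp add: abs_mult)
    have "D < r" using DK \<epsilon> K by (simp add: field_simps)
    \<comment> \<open>Since \<open>D < r\<close>, minimality over the compact piece
      \<open>Z'\<close> is local minimality over \<open>Z\<close> at \<open>y\<close>.\<close>
    define r' where "r' = r - D"
    have "r' > 0" using \<open>D < r\<close> by (simp add: r'_def)
    moreover have "\<phi> z y \<le> \<phi> z y'" if "y' \<in> ball y r'" "y' \<in> Z" for y'
    proof (rule y(2))
      have "dist x y' \<le> dist x y + dist y y'" by (rule dist_triangle)
      then show "y' \<in> Z'" using that by (simp add: Z'_def r'_def D_def d_def dist_norm norm_minus_commute)
    qed
    ultimately obtain \<mu> where "s *\<^sub>R (g y + J z) + (\<tau> / 2) *\<^sub>R (2 *\<^sub>R (y - z)) = \<mu> *\<^sub>R (g y + J y)"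
      using touch[OF phi yr(1)] by metis
    \<comment> \<open>Writing \<open>J z\<close> as \<open>J y - J (y - z)\<close> splits off a
      multiple of \<open>\<alpha> y\<close>, which joins the right-hand side.\<close>
    then have "\<tau> *\<^sub>R (y - z) - s *\<^sub>R J (y - z) = (\<mu> - s) *\<^sub>R \<alpha> y"
      by (simp add: \<alpha>_def linear_diff[OF J] algebra_simps)
    from complex_structure_resolvent_bound[OF J sk JJ \<tau> s this]
    have 1: "norm (y - z) * norm (\<alpha> y) \<le> 2 * \<bar>\<alpha> y \<bullet> (y - z)\<bar>" .
    have \<alpha>x: "\<alpha> x = a" using a by (simp add: \<alpha>_def)
    have close: "norm (\<alpha> y - a) \<le> norm a / 8" using r2(2)[OF yr(4)] by (simp add: \<alpha>x dist_norm)
    have "norm a \<le> norm (\<alpha> y) + norm a / 8"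
      using norm_triangle_ineq2[of a "\<alpha> y"] close by (simp add: norm_minus_commute)
    then have 2: "7/8 * (norm (y - z) * norm a) \<le> norm (y - z) * norm (\<alpha> y)"
      using mult_left_mono[of "7/8 * norm a" "norm (\<alpha> y)" "norm (y - z)"] by (simp add: algebra_simps)
    have "a \<bullet> (y - z) = a \<bullet> d" using \<zeta> by (simp add: z_def d_def inner_simps)
    then have 3: "\<alpha> y \<bullet> (y - z) = a \<bullet> d + (\<alpha> y - a) \<bullet> (y - z)" by (simp add: inner_diff_left)
    have 4: "\<bar>(\<alpha> y - a) \<bullet> (y - z)\<bar> \<le> 1/8 * (norm (y - z) * norm a)"
      using Cauchy_Schwarz_ineq2[of "\<alpha> y - a" "y - z"] mult_right_mono[OF close, of "norm (y - z)"]
      by (simp add: algebra_simps)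
    have "norm (y - z) * norm a \<le> 4 * \<bar>a \<bullet> d\<bar>"
      using 1 2 4 abs_triangle_ineq[of "a \<bullet> d" "(\<alpha> y - a) \<bullet> (y - z)"] unfolding 3 by argo
    also have "\<dots> \<le> 4 * ((B + c + 1) * (K\<^sup>2 * \<epsilon>\<^sup>2))" using ad by simp
    finally have "norm (y - z) \<le> C * \<epsilon>\<^sup>2" using a by (simp add: C_def field_simps)
    then show ?thesis using y unfolding z_def by blast
  qed
  show thesis
    by (rule that[of "r / K" \<tau> C Z']) (use main r K \<tau> C in \<open>auto simp: \<phi>_def\<close>)
qed

section \<open>The polygon argument\<close>

lemma exists_unit_orthogonal_pair:
  fixes p q :: "'a::euclidean_space"
  assumes "DIM('a) > 2"
  obtains a where "norm a = 1" "p \<bullet> a = 0" "q \<bullet> a = 0"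
proof -
  have "card {p, q} \<le> 2" by (simp add: card_insert_if)
  moreover have "dim {p, q} \<le> card {p, q}" by (intro dim_le_card span_superset) simp
  ultimately have "dim {p, q} < DIM('a)" using assms by linarith
  then obtain b where b: "b \<noteq> 0" "\<And>y. y \<in> span {p, q} \<Longrightarrow> orthogonal b y"
    using orthogonal_to_subspace_exists by blast
  have "b \<bullet> p = 0" "b \<bullet> q = 0" using b(2) by (auto simp: orthogonal_def span_base)
  then show thesis using b(1) that[of "sgn b"]
    by (simp add: norm_sgn sgn_div_norm inner_commute)
qed

text \<open>With \<open>t\<close> half the angle, the difference of the two sides is
  \<open>2 * sin t * (cos t - \<tau> * sin t)\<close>, which is positive for small
  \<open>t > 0\<close>.\<close>

lemma exists_small_angle:
  fixes \<tau> :: real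
  obtains k :: nat where "k > 0" "sin (2 * pi / k) > \<tau> * (1 - cos (2 * pi / k))"
proof -
  have t0: "(\<lambda>k. pi / real k) \<longlonglongrightarrow> 0" by (rule lim_const_over_n)
  have "(\<lambda>k. cos (pi / real k) - \<tau> * sin (pi / real k)) \<longlonglongrightarrow> cos 0 - \<tau> * sin 0"
    by (intro tendsto_intros t0)
  then have "\<forall>\<^sub>F k in sequentially. cos (pi / real k) - \<tau> * sin (pi / real k) > 0"
    by (intro order_tendstoD(1)) auto
  moreover have "\<forall>\<^sub>F k::nat in sequentially. k > 1" by (rule eventually_gt_at_top)
  ultimately have "\<forall>\<^sub>F k::nat in sequentially. k > 1 \<and> cos (pi / real k) - \<tau> * sin (pi / real k) > 0"
    by eventually_elim auto
  then obtain k :: nat where k: "k > 1" "cos (pi / real k) - \<tau> * sin (pi / real k) > 0"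
    using eventually_happens'[OF sequentially_bot] by blast
  define t where "t = pi / real k"
  have t: "2 * pi / real k = 2 * t" by (simp add: t_def)
  have "0 < t" "t < pi" using k(1) by (auto simp: t_def field_simps)
  then have "sin t > 0" by (rule sin_gt_zero)
  then have "2 * sin t * (cos t - \<tau> * sin t) > 0" using k by (simp add: t_def)
  then have "sin (2 * t) > \<tau> * (1 - cos (2 * t))"
    unfolding sin_double cos_double_sin by (simp add: power2_eq_square algebra_simps)
  then show thesis using that[of k] k t by simp
qed

text \<open>Each edge of the polygon gains \<open>\<epsilon>\<^sup>2 * \<kappa>\<close> up to a
  cubic error, while the values of \<open>u\<close> telescope around the polygon.\<close>

lemma cyclic_minimiser_contradiction:
  fixes u :: "'a::euclidean_space \<Rightarrow> real" and J :: "'a \<Rightarrow> 'a"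
  assumes J: "linear J" and sk: "\<And>h. J h \<bullet> h = 0" and JJ: "\<And>h. J (J h) = - h"
    and dim: "DIM('a) > 2" and s: "\<bar>s\<bar> = (1::real)"
    and pos: "\<epsilon>0 > 0" "\<tau> > 0" "C \<ge> 0"
    and min: "\<And>\<epsilon> \<zeta>. 0 < \<epsilon> \<Longrightarrow> \<epsilon> < \<epsilon>0 \<Longrightarrow> norm \<zeta> = 1 \<Longrightarrow> a \<bullet> \<zeta> = 0 \<Longrightarrow>
      \<exists>y\<in>Z. norm (y - (x + \<epsilon> *\<^sub>R \<zeta>)) \<le> C * \<epsilon>\<^sup>2 \<and>
        (\<forall>y'\<in>Z. s * (u y + J (x + \<epsilon> *\<^sub>R \<zeta>) \<bullet> y) + \<tau> / 2 * (norm (y - (x + \<epsilon> *\<^sub>R \<zeta>)))\<^sup>2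
          \<le> s * (u y' + J (x + \<epsilon> *\<^sub>R \<zeta>) \<bullet> y') + \<tau> / 2 * (norm (y' - (x + \<epsilon> *\<^sub>R \<zeta>)))\<^sup>2)"
  shows False
proof -
  \<comment> \<open>By skewness, orthogonality of \<open>b\<close> to \<open>J a\<close> makes
    \<open>J b\<close> orthogonal to \<open>a\<close>, so the whole plane of the polygon is
    orthogonal to \<open>a\<close>.\<close>
  obtain b where b: "norm b = 1" "a \<bullet> b = 0" "J a \<bullet> b = 0"
    using exists_unit_orthogonal_pair[OF dim] by metis
  obtain k :: nat where k: "k > 0" "sin (2 * pi / k) > \<tau> * (1 - cos (2 * pi / k))"
    using exists_small_angle by metis
  define \<theta> where "\<theta> = 2 * pi / k"
  \<comment> \<open>The area term of one edge minus the cost of the quadratic penalty.\<close>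
  define \<kappa> where "\<kappa> = sin \<theta> - \<tau> * (1 - cos \<theta>)"
  have \<kappa>: "\<kappa> > 0" using k by (simp add: \<kappa>_def \<theta>_def)
  have ss: "s * s = 1" using s by (simp add: abs_if split: if_splits)
  \<comment> \<open>vertices of a regular \<open>k\<close>-gon, with orientation chosen by the sign \<open>s\<close>\<close>
  define \<zeta> where "\<zeta> i = cos (real i * \<theta>) *\<^sub>R b - (s * sin (real i * \<theta>)) *\<^sub>R J b" for i :: nat
  have bb: "b \<bullet> b = 1" "J b \<bullet> J b = 1" "J b \<bullet> b = 0" "b \<bullet> J b = 0"
    using b complex_structure_norm[OF J sk JJ, of b] sk[of b]
    by (simp_all add: inner_commute flip: power2_norm_eq_inner)
  have inn: "\<zeta> i \<bullet> \<zeta> j = cos (real i * \<theta> - real j * \<theta>)" for i j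
    using ss by (simp add: \<zeta>_def inner_simps bb cos_diff algebra_simps)
  have n1: "norm (\<zeta> i) = 1" for i using inn[of i i] by (simp add: norm_eq_sqrt_inner)
  have orth: "a \<bullet> \<zeta> i = 0" for i
    using b skew_inner[OF J sk, of a b] by (simp add: \<zeta>_def inner_simps)
  have Jinn: "- s * (J (\<zeta> i) \<bullet> \<zeta> j) = sin (real j * \<theta> - real i * \<theta>)" for i j
  proof -
    have "J (\<zeta> i) = cos (real i * \<theta>) *\<^sub>R J b + (s * sin (real i * \<theta>)) *\<^sub>R b"
      by (simp add: \<zeta>_def linear_diff[OF J] linear_cmul[OF J] JJ)
    then have "- s * (J (\<zeta> i) \<bullet> \<zeta> j) = (s * s) * sin (real j * \<theta> - real i * \<theta>)"
      by (simp add: \<zeta>_def inner_simps bb sin_diff algebra_simps)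
    then show ?thesis by (simp add: ss)
  qed
  have per: "\<zeta> k = \<zeta> 0" using k by (simp add: \<zeta>_def \<theta>_def)
  \<comment> \<open>The cubic errors of one edge: from pairing \<open>J p\<close> with the
    displacements, from the cross term of the penalty, and from the squared displacement.\<close>
  define D where "D = 2 * C + 2 * \<tau> * C + \<tau> * C\<^sup>2"
  have D: "D \<ge> 0" using pos by (simp add: D_def)
  define \<epsilon> where "\<epsilon> = min (\<epsilon>0 / 2) (min 1 (\<kappa> / (2 * (D + 1))))"
  have "0 < \<epsilon>" "\<epsilon> < \<epsilon>0" "\<epsilon> \<le> 1" "\<epsilon> \<le> \<kappa> / (2 * (D + 1))"
    using pos \<kappa> D by (auto simp: \<epsilon>_def)
  note \<epsilon> = this
  define z where "z i = x + \<epsilon> *\<^sub>R \<zeta> i" for i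
  \<comment> \<open>The choice depends on the centre rather than on the index, so coinciding first
    and last vertices get the same minimiser and the sum closes up.\<close>
  define Y where "Y q = (SOME y. y \<in> Z \<and> norm (y - q) \<le> C * \<epsilon>\<^sup>2 \<and> (\<forall>y'\<in>Z.
      s * (u y + J q \<bullet> y) + \<tau> / 2 * (norm (y - q))\<^sup>2 \<le>
      s * (u y' + J q \<bullet> y') + \<tau> / 2 * (norm (y' - q))\<^sup>2))" for q
  have "Y (z i) \<in> Z \<and> norm (Y (z i) - z i) \<le> C * \<epsilon>\<^sup>2 \<and> (\<forall>y'\<in>Z.
      s * (u (Y (z i)) + J (z i) \<bullet> Y (z i)) + \<tau> / 2 * (norm (Y (z i) - z i))\<^sup>2 \<le>
      s * (u y' + J (z i) \<bullet> y') + \<tau> / 2 * (norm (y' - z i))\<^sup>2)" for i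
    using min[OF \<epsilon>(1,2) n1 orth, of i, folded z_def, unfolded Bex_def]
    unfolding Y_def by (rule someI_ex)
  then have Y: "Y (z i) \<in> Z" "norm (Y (z i) - z i) \<le> C * \<epsilon>\<^sup>2"
    "y' \<in> Z \<Longrightarrow> s * (u (Y (z i)) + J (z i) \<bullet> Y (z i)) + \<tau> / 2 * (norm (Y (z i) - z i))\<^sup>2 \<le>
      s * (u y' + J (z i) \<bullet> y') + \<tau> / 2 * (norm (y' - z i))\<^sup>2" for i y'
    by blast+
  define G where "G y = s * (u y + J x \<bullet> y)" for y
  define y where "y i = Y (z i)" for i
  have step: "G (y i) - G (y (Suc i)) + \<epsilon>\<^sup>2 * \<kappa> \<le> D * \<epsilon> ^ 3" for i
  proof -
    define r where "r = y i - z i"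
    define r' where "r' = y (Suc i) - z (Suc i)"
    have r: "norm r \<le> C * \<epsilon>\<^sup>2" "norm r' \<le> C * \<epsilon>\<^sup>2" using Y(2) by (auto simp: r_def r'_def y_def)
    define p where "p = \<zeta> i"
    define p' where "p' = \<zeta> (Suc i)"
    have pp: "p \<bullet> p = 1" "p' \<bullet> p' = 1" "p \<bullet> p' = cos \<theta>" "p' \<bullet> p = cos \<theta>" "- s * (J p \<bullet> p') = sin \<theta>" "J p \<bullet> p = 0"
      using inn[of i i] inn[of "Suc i" "Suc i"] inn[of i "Suc i"] inn[of "Suc i" i] Jinn[of i "Suc i"] sk[of p]
      by (simp_all add: p_def p'_def algebra_simps)
    have yi: "y i = x + \<epsilon> *\<^sub>R p + r" "y (Suc i) = x + \<epsilon> *\<^sub>R p' + r'"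
      by (simp_all add: r_def r'_def z_def p_def p'_def)
    have Jz: "J (z i) = J x + \<epsilon> *\<^sub>R J p" by (simp add: z_def p_def linear_add[OF J] linear_cmul[OF J])
    have "s * \<epsilon> * (J p \<bullet> (y i - y (Suc i))) = \<epsilon>\<^sup>2 * (- s * (J p \<bullet> p')) + s * \<epsilon> * (J p \<bullet> (r - r'))"
      unfolding yi by (simp add: inner_simps pp(6) power2_eq_square algebra_simps)
    then have cross: "s * \<epsilon> * (J p \<bullet> (y i - y (Suc i))) = \<epsilon>\<^sup>2 * sin \<theta> + s * \<epsilon> * (J p \<bullet> (r - r'))"
      unfolding pp(5) .
    \<comment> \<open>Minimality of \<open>y i\<close> for its own centre, tested against the next
      minimiser. \<open>G\<close> is the part of the functional that does not depend on the
      centre.\<close>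
    have "G (y i) - G (y (Suc i)) + s * \<epsilon> * (J p \<bullet> (y i - y (Suc i)))
        + \<tau> / 2 * (norm r)\<^sup>2 - \<tau> / 2 * (norm (y (Suc i) - z i))\<^sup>2 \<le> 0"
      using Y(3)[of "y (Suc i)" i] Y(1)[of "Suc i"]
      by (simp add: G_def Jz y_def[symmetric] r_def[symmetric] inner_simps algebra_simps)
    moreover note cross
    moreover have "\<bar>s * \<epsilon> * (J p \<bullet> (r - r'))\<bar> \<le> \<epsilon> * (2 * C * \<epsilon>\<^sup>2)"
    proof -
      have "\<bar>J p \<bullet> (r - r')\<bar> \<le> norm (r - r')"
        using Cauchy_Schwarz_ineq2[of "J p" "r - r'"] complex_structure_norm[OF J sk JJ, of p] n1
        by (simp add: p_def)
      also have "\<dots> \<le> 2 * C * \<epsilon>\<^sup>2" using norm_triangle_ineq4[of r r'] r by simp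
      finally show ?thesis using s \<epsilon> by (simp add: abs_mult)
    qed
    moreover have 1: "(norm (y (Suc i) - z i))\<^sup>2 = \<epsilon>\<^sup>2 * (2 * (1 - cos \<theta>)) + 2 * \<epsilon> * ((p' - p) \<bullet> r') + (norm r')\<^sup>2"
      unfolding yi z_def p_def[symmetric] power2_norm_eq_inner
      by (simp add: inner_simps inner_commute[of r' p] inner_commute[of r' p'] pp power2_eq_square algebra_simps)
    moreover have 2: "2 * \<epsilon> * ((p' - p) \<bullet> r') \<le> 4 * C * \<epsilon> ^ 3"
    proof -
      have "(p' - p) \<bullet> r' \<le> norm (p' - p) * norm r'" by (rule norm_cauchy_schwarz)
      also have "\<dots> \<le> 2 * (C * \<epsilon>\<^sup>2)"
        using norm_triangle_ineq4[of p' p] n1 r by (intro mult_mono) (auto simp: p_def p'_def)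
      finally have "2 * \<epsilon> * ((p' - p) \<bullet> r') \<le> 2 * \<epsilon> * (2 * (C * \<epsilon>\<^sup>2))"
        using \<epsilon> by (intro mult_left_mono) auto
      then show ?thesis by (simp add: power2_eq_square power3_eq_cube algebra_simps)
    qed
    moreover have 3: "(norm r')\<^sup>2 \<le> 2 * C\<^sup>2 * \<epsilon> ^ 3"
    proof -
      have "(norm r')\<^sup>2 \<le> (C * \<epsilon>\<^sup>2)\<^sup>2" using r by (intro power_mono) auto
      also have "\<dots> = (C\<^sup>2 * \<epsilon> ^ 3) * \<epsilon>" by (simp add: power2_eq_square power3_eq_cube)
      also have "\<dots> \<le> (C\<^sup>2 * \<epsilon> ^ 3) * 2" using \<epsilon> by (intro mult_left_mono) auto
      finally show ?thesis by simp
    qed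
    moreover have "\<tau> / 2 * (norm (y (Suc i) - z i))\<^sup>2
        \<le> \<tau> / 2 * (\<epsilon>\<^sup>2 * (2 * (1 - cos \<theta>)) + 4 * C * \<epsilon> ^ 3 + 2 * C\<^sup>2 * \<epsilon> ^ 3)"
      using 1 2 3 pos(2) by (intro mult_left_mono) linarith+
    moreover have "0 \<le> \<tau> / 2 * (norm r)\<^sup>2" using pos(2) by simp
    ultimately have "G (y i) - G (y (Suc i)) + \<epsilon>\<^sup>2 * sin \<theta> - \<epsilon> * (2 * C * \<epsilon>\<^sup>2)
        - \<tau> / 2 * (\<epsilon>\<^sup>2 * (2 * (1 - cos \<theta>)) + 4 * C * \<epsilon> ^ 3 + 2 * C\<^sup>2 * \<epsilon> ^ 3) \<le> 0"
      by linarith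
    then show ?thesis
      by (simp add: D_def \<kappa>_def power2_eq_square power3_eq_cube algebra_simps)
  qed
  have "(\<Sum>i<k. G (y i) - G (y (Suc i)) + \<epsilon>\<^sup>2 * \<kappa>) \<le> (\<Sum>i<k. D * \<epsilon> ^ 3)"
    by (intro sum_mono step)
  moreover have "(\<Sum>i<k. G (y i) - G (y (Suc i))) = 0"
    by (subst sum_lessThan_telescope') (simp add: y_def z_def per)
  ultimately have "real k * (\<epsilon>\<^sup>2 * \<kappa>) \<le> real k * (D * \<epsilon> ^ 3)" by (simp add: sum.distrib)
  then have "\<kappa> \<le> D * \<epsilon>" using k \<epsilon> by (simp add: power2_eq_square power3_eq_cube)
  also have "\<dots> \<le> D * (\<kappa> / (2 * (D + 1)))" using \<epsilon> D by (intro mult_left_mono)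
  also have "\<dots> < \<kappa>" using \<kappa> D by (simp add: field_simps add_nonneg_pos)
  finally show False by simp
qed

text \<open>If \<open>Z\<close> were not open, a point outside it would have a nearest point
  \<open>x\<close> in \<open>Z\<close> near which \<open>Z\<close> lies outside a ball. The touching
  property aligns the normal of this ball with \<open>g x + J x\<close>, which supplies the
  one-sided bound needed for the minimisers.\<close>

lemma contact_set_eq_domain:
  fixes u :: "'a::euclidean_space \<Rightarrow> real" and J :: "'a \<Rightarrow> 'a"
  assumes U: "open U" "connected U" and u: "twice_diff u g T U"
    and J: "linear J" and sk: "\<And>h. J h \<bullet> h = 0" and JJ: "\<And>h. J (J h) = - h"
    and dim: "DIM('a) > 2"
    and nz: "\<And>y. y \<in> U \<Longrightarrow> g y + J y \<noteq> 0"
    and Z: "closedin (top_of_set U) Z" "Z \<noteq> {}"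
    and touch: "\<And>\<phi> g\<phi> T\<phi> x r. twice_diff \<phi> g\<phi> T\<phi> U \<Longrightarrow> x \<in> Z \<Longrightarrow> r > 0 \<Longrightarrow>
        (\<And>y. y \<in> ball x r \<Longrightarrow> y \<in> Z \<Longrightarrow> \<phi> x \<le> \<phi> y) \<Longrightarrow> \<exists>\<mu>. g\<phi> x = \<mu> *\<^sub>R (g x + J x)"
  shows "Z = U"
proof (rule ccontr)
  assume ne: "Z \<noteq> U"
  have ZU: "Z \<subseteq> U" using Z closedin_imp_subset by fastforce
  have "\<not> openin (top_of_set U) Z" using U(2) Z ne unfolding connected_clopen by blast
  then have "\<not> open Z" using ZU U(1) by (simp add: openin_open_eq)
  then obtain p where p: "p \<in> Z" "\<And>e. e > 0 \<Longrightarrow> \<not> ball p e \<subseteq> Z"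
    unfolding open_contains_ball by blast
  then obtain R where R: "R > 0" "cball p R \<subseteq> U" using ZU U(1) open_contains_cball by blast
  \<comment> \<open>The nearest point of \<open>Z\<close> is then closer than \<open>R / 2\<close>
    to \<open>q\<close>, hence strictly inside the ball of radius \<open>R\<close> about
    \<open>p\<close>.\<close>
  obtain q where q: "q \<in> ball p (R / 2)" "q \<notin> Z" using p(2)[of "R / 2"] R(1) by (meson half_gt_zero subsetI)
  obtain K where K: "closed K" "Z = U \<inter> K" using Z by (auto simp: closedin_closed)
  have ZK: "Z \<inter> cball p R = cball p R \<inter> K" using K R by auto
  have "compact (Z \<inter> cball p R)" unfolding ZK using K by (intro compact_Int_closed) auto
  moreover have "Z \<inter> cball p R \<noteq> {}" using p R by auto
  moreover have "continuous_on (Z \<inter> cball p R) (dist q)" by (intro continuous_intros)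
  ultimately obtain x where x: "x \<in> Z \<inter> cball p R" "\<And>y. y \<in> Z \<inter> cball p R \<Longrightarrow> dist q x \<le> dist q y"
    using continuous_attains_inf by metis
  have "dist q x \<le> dist q p" using x(2)[of p] p R by auto
  then have "dist p x < R" using q dist_triangle[of p x q] by (simp add: dist_commute)
  define \<rho> where "\<rho> = R - dist p x"
  have \<rho>: "\<rho> > 0" using \<open>dist p x < R\<close> by (simp add: \<rho>_def)
  have near: "dist q x \<le> dist q y" if "y \<in> ball x \<rho>" "y \<in> Z" for y
    using x(2)[of y] that dist_triangle[of p y x] by (simp add: \<rho>_def)
  have xZ: "x \<in> Z" and xU: "x \<in> U" and xq: "x \<noteq> q" using x ZU q by auto
  define a where "a = g x + J x"
  have a0: "a \<noteq> 0" using nz[OF xU] by (simp add: a_def)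
  have near2: "(x - q) \<bullet> (x - q) \<le> (y - q) \<bullet> (y - q)" if "y \<in> ball x \<rho>" "y \<in> Z" for y
    using power_mono[OF near[OF that], of 2]
    by (simp add: dist_norm norm_minus_commute flip: power2_norm_eq_inner)
  obtain \<mu> where mu: "2 *\<^sub>R (x - q) = \<mu> *\<^sub>R a"
    using touch[OF twice_diff_norm2 xZ \<rho> near2] unfolding a_def by blast
  have \<mu>0: "\<mu> \<noteq> 0" using mu xq by auto
  \<comment> \<open>The sign for which \<open>s *\<^sub>R a\<close> points from \<open>q\<close>
    towards \<open>x\<close>.\<close>
  define s where "s = sgn \<mu>"
  have s: "\<bar>s\<bar> = 1" using \<mu>0 by (simp add: s_def abs_sgn_eq)
  have prox: "s * (a \<bullet> (y - x)) \<ge> - (1 / \<bar>\<mu>\<bar>) * (norm (y - x))\<^sup>2" if "y \<in> Z" "y \<in> ball x \<rho>" for y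
  proof -
    \<comment> \<open>Expanding the squared distance to \<open>q\<close> about \<open>x\<close>
      turns the exterior ball into a quadratic lower bound with constant
      \<open>1 / \<bar>\<mu>\<bar>\<close>.\<close>
    have "(y - q) \<bullet> (y - q) = (y - x) \<bullet> (y - x) + (2 *\<^sub>R (x - q)) \<bullet> (y - x) + (x - q) \<bullet> (x - q)"
      by (simp add: inner_simps inner_commute algebra_simps)
    then have "\<mu> * (a \<bullet> (y - x)) \<ge> - (norm (y - x))\<^sup>2"
      using near2[OF that(2,1)] unfolding mu by (simp add: power2_norm_eq_inner)
    moreover have "\<mu> = s * \<bar>\<mu>\<bar>" by (simp add: s_def sgn_mult_abs)
    ultimately have "\<bar>\<mu>\<bar> * (s * (a \<bullet> (y - x))) \<ge> - (norm (y - x))\<^sup>2"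
      by (metis mult.assoc mult.commute)
    then show ?thesis using \<mu>0 by (simp add: field_simps)
  qed
  have c: "1 / \<bar>\<mu>\<bar> \<ge> 0" by simp
  show False
  proof (rule penalised_minimiser_near_centre[OF U(1) u J sk JJ Z(1) _ xZ a_def a0 s c \<rho> prox])
    fix \<phi> g\<phi> T\<phi> x r
    assume "twice_diff \<phi> g\<phi> T\<phi> U" "x \<in> Z" "0 < (r::real)" "\<And>y. y \<in> ball x r \<Longrightarrow> y \<in> Z \<Longrightarrow> \<phi> x \<le> \<phi> y"
    then show "\<exists>\<mu>. g\<phi> x = \<mu> *\<^sub>R (g x + J x)" by (rule touch)
  qed (assumption, assumption, rule cyclic_minimiser_contradiction[OF J sk JJ dim s])
qed

section \<open>Coordinates\<close>

lemma sum_Basis_vec: "(\<Sum>b\<in>(Basis :: (real ^ 'm::finite) set). f b) = (\<Sum>i\<in>UNIV. f (axis i 1))"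
proof -
  have B: "(Basis :: (real ^ 'm) set) = range (\<lambda>i. axis i 1)" by (auto simp: Basis_vec_def)
  have "inj (\<lambda>i::'m. axis i (1::real))" by (auto simp: inj_def axis_eq_axis)
  from sum.reindex[OF this, of f] show ?thesis unfolding B by (simp add: comp_def)
qed

text \<open>The rows of the Hessian are the gradients of the first partial derivatives. Continuity
  of the second partials bounds each row near \<open>x\<close>, and the sum of these bounds controls
  the whole operator.\<close>

lemma C2_twice_diff:
  fixes u :: "real ^ 'm::finite \<Rightarrow> real"
  assumes U: "open U" and u: "C_k_on 2 u U"
  shows "twice_diff u (grad u) (\<lambda>x h. \<chi> i. h \<bullet> grad (partial_deriv i u) x) U"
  unfolding twice_diff_def
proof (intro ballI conjI)
  fix x assume x: "x \<in> U"
  have d1: "u differentiable (at y)" and d2: "partial_deriv i u differentiable (at y)"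
    if "y \<in> U" for i y
    using u U that by (auto simp: numeral_2_eq_2 differentiable_on_eq_differentiable_at)
  have c: "continuous_on U (partial_deriv j (partial_deriv i u))" for i j
    using u by (auto simp: numeral_2_eq_2)
  show "GDERIV u x :> grad u x" using d1[OF x] by (rule GDERIV_grad)
  show "(grad u has_derivative (\<lambda>h. \<chi> i. h \<bullet> grad (partial_deriv i u) x)) (at x)"
    using GDERIV_grad[OF d2[OF x]]
    by (subst has_derivative_componentwise_within)
      (auto simp: Basis_vec_def inner_axis grad_def[of u] gderiv_def)
  have "isCont (\<lambda>y. grad (partial_deriv i u) y) x" for i
    unfolding grad_def isCont_def using c U x
    by (intro tendsto_vec_lambda) (auto simp: continuous_on_eq_continuous_at isCont_def)
  then have "\<forall>\<^sub>F y in nhds x. norm (grad (partial_deriv i u) y) < norm (grad (partial_deriv i u) x) + 1" for i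
    by (intro order_tendstoD(2)[OF tendsto_norm]) (auto simp: isCont_def tendsto_at_iff_tendsto_nhds)
  then have "\<forall>\<^sub>F y in nhds x. \<forall>i. norm (grad (partial_deriv i u) y) < norm (grad (partial_deriv i u) x) + 1"
    by (intro eventually_all_finite)
  then have "\<forall>\<^sub>F y in nhds x. \<forall>h. norm (\<chi> i. h \<bullet> grad (partial_deriv i u) y)
      \<le> (\<Sum>i\<in>UNIV. norm (grad (partial_deriv i u) x) + 1) * norm h"
  proof eventually_elim
    case (elim y)
    show ?case
    proof
      fix h
      have "norm (\<chi> i. h \<bullet> grad (partial_deriv i u) y) \<le> (\<Sum>i\<in>UNIV. \<bar>h \<bullet> grad (partial_deriv i u) y\<bar>)"
        using norm_le_l1_cart[of "\<chi> i. h \<bullet> grad (partial_deriv i u) y"] by simp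
      also have "\<dots> \<le> (\<Sum>i\<in>UNIV. (norm (grad (partial_deriv i u) x) + 1) * norm h)"
      proof (rule sum_mono)
        fix i
        have "\<bar>h \<bullet> grad (partial_deriv i u) y\<bar> \<le> norm h * norm (grad (partial_deriv i u) y)"
          by (rule Cauchy_Schwarz_ineq2)
        also have "\<dots> \<le> norm h * (norm (grad (partial_deriv i u) x) + 1)"
          using elim by (intro mult_left_mono) (auto simp: less_imp_le)
        finally show "\<bar>h \<bullet> grad (partial_deriv i u) y\<bar> \<le> (norm (grad (partial_deriv i u) x) + 1) * norm h"
          by (simp add: mult.commute)
      qed
      finally show "norm (\<chi> i. h \<bullet> grad (partial_deriv i u) y)
          \<le> (\<Sum>i\<in>UNIV. norm (grad (partial_deriv i u) x) + 1) * norm h"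
        by (simp add: sum_distrib_right)
    qed
  qed
  then show "\<exists>B. \<forall>\<^sub>F y in nhds x. \<forall>h. norm (\<chi> i. h \<bullet> grad (partial_deriv i u) y) \<le> B * norm h"
    by blast
qed

section \<open>The divergence of a normalised vector field\<close>

lemma has_derivative_sgn:
  fixes \<alpha> :: "'a::euclidean_space \<Rightarrow> 'b::euclidean_space"
  assumes d: "(\<alpha> has_derivative A) (at x)" and nz: "\<alpha> x \<noteq> 0"
  shows "((\<lambda>y. sgn (\<alpha> y)) has_derivative
    (\<lambda>h. (1 / norm (\<alpha> x)) *\<^sub>R (A h - (sgn (\<alpha> x) \<bullet> A h) *\<^sub>R sgn (\<alpha> x)))) (at x)"
proof -
  have "((\<lambda>y. norm (\<alpha> y)) has_derivative (\<lambda>h. sgn (\<alpha> x) \<bullet> A h)) (at x)"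
    using has_derivative_compose[OF d has_derivative_norm[OF nz]] by (simp add: inner_commute)
  from has_derivative_scaleR[OF Deriv.has_derivative_inverse[OF _ this] d] nz
  have D: "((\<lambda>y. inverse (norm (\<alpha> y)) *\<^sub>R \<alpha> y) has_derivative
    (\<lambda>h. inverse (norm (\<alpha> x)) *\<^sub>R A h + (- (inverse (norm (\<alpha> x)) * (sgn (\<alpha> x) \<bullet> A h) * inverse (norm (\<alpha> x)))) *\<^sub>R \<alpha> x)) (at x)"
    by simp
  have "inverse (norm (\<alpha> x)) *\<^sub>R A h + (- (inverse (norm (\<alpha> x)) * (sgn (\<alpha> x) \<bullet> A h) * inverse (norm (\<alpha> x)))) *\<^sub>R \<alpha> x
    = (1 / norm (\<alpha> x)) *\<^sub>R (A h - (sgn (\<alpha> x) \<bullet> A h) *\<^sub>R sgn (\<alpha> x))" for h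
    by (simp add: sgn_div_norm scaleR_diff_right inverse_eq_divide)
  then show ?thesis using D by (simp add: sgn_div_norm[of "\<alpha> _"])
qed

text \<open>The derivative of the normalised field is \<open>A\<close> followed by projection
  orthogonal to \<open>\<alpha> x\<close>, divided by the norm; the divergence is its trace.\<close>

lemma divergence_sgn:
  fixes \<alpha> :: "real ^ 'm::finite \<Rightarrow> real ^ 'm"
  assumes d: "(\<alpha> has_derivative A) (at x)" and nz: "\<alpha> x \<noteq> 0"
  shows "divergence (\<lambda>y. sgn (\<alpha> y)) x = curv_op (\<alpha> x) A"
proof -
  define N where "N = sgn (\<alpha> x)"
  have A: "linear A" using d by (rule has_derivative_linear)
  have "((\<lambda>y. sgn (\<alpha> y) $ i) has_derivative
      (\<lambda>h. ((1 / norm (\<alpha> x)) *\<^sub>R (A h - (N \<bullet> A h) *\<^sub>R N)) $ i)) (at x)" for i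
    unfolding N_def by (rule bounded_linear.has_derivative[OF bounded_linear_vec_nth has_derivative_sgn[OF d nz]])
  from frechet_derivative_at[OF this, symmetric]
  have "partial_deriv i (\<lambda>y. sgn (\<alpha> y) $ i) x
      = ((1 / norm (\<alpha> x)) *\<^sub>R (A (axis i 1) - (N \<bullet> A (axis i 1)) *\<^sub>R N)) $ i" for i
    unfolding partial_deriv_def by simp
  then have "divergence (\<lambda>y. sgn (\<alpha> y)) x
      = (\<Sum>i\<in>UNIV. A (axis i 1) $ i - (N $ i) * (N \<bullet> A (axis i 1))) / norm (\<alpha> x)"
    by (simp add: divergence_def sum_divide_distrib mult.commute)
  also have "(\<Sum>i\<in>UNIV. A (axis i 1) $ i - (N $ i) * (N \<bullet> A (axis i 1)))
      = trace_op A - N \<bullet> A N"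
  proof -
    have "A N = A (\<Sum>i\<in>UNIV. N $ i *\<^sub>R axis i 1)"
      using basis_expansion[of N] by (simp add: scalar_mult_eq_scaleR)
    also have "\<dots> = (\<Sum>i\<in>UNIV. N $ i *\<^sub>R A (axis i 1))"
      by (simp add: linear_sum[OF A] linear_cmul[OF A])
    finally show ?thesis
      by (simp add: trace_op_def sum_Basis_vec inner_axis sum_subtractf inner_sum_right)
  qed
  finally show ?thesis by (simp add: curv_op_def N_def)
qed

text \<open>A linear field is its own derivative, so this removes the derivative of the twist field
  from the curvature; the field remains only in the vector \<open>p\<close>.\<close>

lemma curv_op_skew:
  assumes "\<And>h. J h \<bullet> h = 0"
  shows "curv_op p J = 0"
  using assms inner_commute[of "sgn p" "J (sgn p)"] by (simp add: curv_op_def trace_op_def)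

lemma H_curv_eq_curv_op:
  fixes u :: "real ^ 'm::finite \<Rightarrow> real"
  assumes u: "twice_diff u (grad u) T U" and x: "x \<in> U"
    and J: "linear J" and sk: "\<And>h. J h \<bullet> h = 0" and nz: "grad u x + J x \<noteq> 0"
  shows "H_curv J u x = curv_op (grad u x + J x) (T x)"
proof -
  have "(J has_derivative J) (at x)"
    using J by (simp add: linear_conv_bounded_linear bounded_linear_imp_has_derivative)
  then have d: "((\<lambda>y. grad u y + J y) has_derivative (\<lambda>h. T x h + J h)) (at x)"
    using twice_diffD(2)[OF u x] by (intro has_derivative_add)
  have "N_field J u = (\<lambda>y. sgn (grad u y + J y))"
    unfolding N_field_def sgn_div_norm inverse_eq_divide ..
  then have "H_curv J u x = curv_op (grad u x + J x) (\<lambda>h. T x h + J h)"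
    using divergence_sgn[OF d nz] by (simp add: H_curv_def)
  also have "\<dots> = curv_op (grad u x + J x) (T x)"
    using curv_op_diff[OF linear_compose_add[OF twice_diffD(3)[OF u x] J] J, of "grad u x + J x"]
      curv_op_skew[of J, OF sk] by simp
  finally show ?thesis .
qed

section \<open>The twist field as a complex structure\<close>

context
  fixes n :: nat and e :: "nat \<Rightarrow> 'm::finite"
  assumes e: "bij_betw e {1..2 * n} UNIV"
begin

lemma linear_twist_field: "linear (twist_field n e)"
  by (rule linearI)
    (simp_all add: twist_field_def algebra_simps sum.distrib scaleR_sum_right sum_subtractf sum_negf)

lemma twist_field_skew: "twist_field n e h \<bullet> h = 0"
  by (simp add: twist_field_def inner_sum_left inner_diff_left inner_axis')

lemma twist_field_nth:
  assumes "k \<in> {1..n}"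
  shows "twist_field n e x $ e (2 * k) = x $ e (2 * k - 1)"
    and "twist_field n e x $ e (2 * k - 1) = - x $ e (2 * k)"
proof -
  have inj: "e i = e j \<longleftrightarrow> i = j" if "i \<in> {1..2 * n}" "j \<in> {1..2 * n}" for i j
    using e that by (metis bij_betw_def inj_on_eq_iff)
  \<comment> \<open>Injectivity of \<open>e\<close> reduces these to parity of the indices;
    \<open>k\<close> and \<open>l\<close> are at least 1, so the natural subtraction does not
    truncate.\<close>
  have E: "e (2 * k) = e (2 * l) \<longleftrightarrow> l = k" "e (2 * k - 1) = e (2 * l - 1) \<longleftrightarrow> l = k"
     "e (2 * k) \<noteq> e (2 * l - 1)" "e (2 * k - 1) \<noteq> e (2 * l)" if "l \<in> {1..n}" for l
  proof -
    have "2 * l \<in> {1..2*n}" "2 * k \<in> {1..2*n}" "2 * l - 1 \<in> {1..2*n}" "2 * k - 1 \<in> {1..2*n}"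
      using that assms by auto
    moreover have "2 * l - 1 = 2 * k - 1 \<longleftrightarrow> l = k" "2 * l - 1 \<noteq> 2 * k" "2 * l \<noteq> 2 * k - 1"
      using that assms unfolding atLeastAtMost_iff by presburger+
    ultimately show "e (2 * k) = e (2 * l) \<longleftrightarrow> l = k" "e (2 * k - 1) = e (2 * l - 1) \<longleftrightarrow> l = k"
     "e (2 * k) \<noteq> e (2 * l - 1)" "e (2 * k - 1) \<noteq> e (2 * l)"
      using inj by auto
  qed
  have "twist_field n e x $ e (2 * k) = (\<Sum>l=1..n. if l = k then x $ e (2 * l - 1) else 0)"
    unfolding twist_field_def sum_component by (intro sum.cong refl) (simp add: axis_def E del: One_nat_def)
  also have "\<dots> = x $ e (2 * k - 1)" using assms by simp
  finally show "twist_field n e x $ e (2 * k) = x $ e (2 * k - 1)" .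
  have "twist_field n e x $ e (2 * k - 1) = (\<Sum>l=1..n. if l = k then - x $ e (2 * l) else 0)"
    unfolding twist_field_def sum_component by (intro sum.cong refl) (simp add: axis_def E del: One_nat_def)
  also have "\<dots> = - x $ e (2 * k)" using assms by simp
  finally show "twist_field n e x $ e (2 * k - 1) = - x $ e (2 * k)" .
qed

lemma twist_field_twist_field: "twist_field n e (twist_field n e x) = - x"
proof -
  have "twist_field n e (twist_field n e x) $ i = (- x) $ i" for i
  proof -
    obtain j where j: "j \<in> {1..2 * n}" "i = e j" using e by (metis UNIV_I bij_betw_def imageE)
    have "\<exists>k\<in>{1..n}. j = 2 * k \<or> j = 2 * k - 1"
      \<comment> \<open>The indices \<open>2 * k - 1\<close> and \<open>2 * k\<close> form the pair
        numbered \<open>k\<close>, which is \<open>(j + 1) div 2\<close> for either of them.\<close>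
      using j(1) by (intro bexI[of _ "(j + 1) div 2"]) auto
    then show ?thesis using j twist_field_nth by auto
  qed
  then show ?thesis by (simp add: vec_eq_iff)
qed

end

theorem corollaryI:
  fixes n :: nat
    and e :: "nat \<Rightarrow> 'm::finite"
    and U :: "(real ^ 'm) set"
    and F :: "real ^ 'm \<Rightarrow> real ^ 'm"
    and u v :: "real ^ 'm \<Rightarrow> real"
    and p\<^sub>0 :: "real ^ 'm"
  assumes "n \<ge> 2"
    and "bij_betw e {1..2 * n} UNIV"
    and "open U" and "connected U"
    and "F = twist_field n e"
    and "C_k_on 2 u U" and "C_k_on 2 v U"
    and "\<And>x. x \<in> U \<Longrightarrow> grad u x + F x \<noteq> 0"
    and "\<And>x. x \<in> U \<Longrightarrow> grad v x + F x \<noteq> 0"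
    and "\<And>x. x \<in> U \<Longrightarrow> H_curv F u x \<le> H_curv F v x"
    and "\<And>x. x \<in> U \<Longrightarrow> u x \<ge> v x"
    and "p\<^sub>0 \<in> U" and "u p\<^sub>0 = v p\<^sub>0"
  shows "\<forall>x\<in>U. u x = v x"
proof -
  note e = assms(2) and F = assms(5)
  define Z where "Z = {x \<in> U. u x = v x}"
  define Tu where "Tu x h = (\<chi> i. h \<bullet> grad (partial_deriv i u) x)" for x h
  define Tv where "Tv x h = (\<chi> i. h \<bullet> grad (partial_deriv i v) x)" for x h
  have u: "twice_diff u (grad u) Tu U" and v: "twice_diff v (grad v) Tv U"
    unfolding Tu_def Tv_def using assms by (auto intro!: C2_twice_diff)
  have J: "linear F" and sk: "\<And>h. F h \<bullet> h = 0" and JJ: "\<And>h. F (F h) = - h"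
    unfolding F using linear_twist_field[OF e] twist_field_skew[OF e] twist_field_twist_field[OF e]
    by auto
  have curv: "curv_op (grad u y + F y) (Tu y) \<le> curv_op (grad v y + F y) (Tv y)" if "y \<in> U" for y
    using assms(10)[OF that] H_curv_eq_curv_op[OF u that J sk assms(8)[OF that]]
      H_curv_eq_curv_op[OF v that J sk assms(9)[OF that]] by simp
  have cF: "continuous_on U F"
    using J by (simp add: linear_continuous_on linear_conv_bounded_linear)
  \<comment> \<open>Here \<open>n \<ge> 2\<close> enters: dimension above 2 leaves room for a vector
    orthogonal to both \<open>a\<close> and \<open>J a\<close>.\<close>
  have "CARD('m) = 2 * n" using bij_betw_same_card[OF e] by simp
  then have dim: "DIM(real ^ 'm) > 2" using assms(1) by simp
  have "continuous_on U (\<lambda>x. u x - v x)"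
    using twice_diffD(4)[OF u] twice_diffD(4)[OF v]
    by (intro continuous_intros continuous_at_imp_continuous_on) auto
  then have "closedin (top_of_set U) {x \<in> U. u x - v x = 0}"
    by (rule continuous_closedin_preimage_constant)
  then have "closedin (top_of_set U) Z" by (simp add: Z_def)
  moreover have "Z \<noteq> {}" using assms by (auto simp: Z_def)
  moreover have "\<exists>\<mu>. g\<phi> x = \<mu> *\<^sub>R (grad u x + F x)"
    if "twice_diff \<phi> g\<phi> T\<phi> U" "x \<in> Z" "r > 0" "\<And>y. y \<in> ball x r \<Longrightarrow> y \<in> Z \<Longrightarrow> \<phi> x \<le> \<phi> y"
    for \<phi> g\<phi> T\<phi> x r
    by (rule touching_gradient[OF assms(3) u v that(1) cF assms(8,9) curv assms(11) _ _ that(3)])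
      (use that(2,4) in \<open>auto simp: Z_def\<close>)
  ultimately have "Z = U"
    using contact_set_eq_domain[OF assms(3,4) u J sk JJ dim assms(8)] by blast
  then show ?thesis by (auto simp: Z_def)
qed

end
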